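(* Let $G$ be a $\overline{2P_3}$-free cobipartite graph with at least two vertices such that $\overline{G}$ is right-Sperner, and let $(A,B)$ be a bipartition of $\overline{G}$ such that the labeled bigraph $(\overline{G},A,B)$ is right-Sperner. Then there exists a partition of $A$ as $A = \{z\}\cup A^1\cup A^2$ and a partition of $B$ as $B = B^1\cup B^2$ such that $\{\{z\},A^1,A^2,B^1,B^2\}$ is an $M[1,1]$-partition of $G$ (rows and columns indexed in order by $\{z\},A^1,A^2,B^1,B^2$) such that the subgraphs of $G$ induced by $A^1\cup B^1$ and $A^2\cup B^2$ are $\overline{2P_3}$-free and their complements are right-Sperner. Moreover, given a $\overline{2P_3}$-free cobipartite graph $G$, one can compute in time $\mathcal{O}(|V(G)|^3)$ a bipartition $(A,B)$ of $\overline{G}$ such that $(\overline{G},A,B)$ is right-Sperner, together with an $M[1,1]$-partition $\{\{z\},A^1,A^2,B^1,B^2\}$ of $G$ with $A=\{z\}\cup A^1\cup A^2$, $B=B^1\cup B^2$ such that the subgraphs of $G$ induced by $A^1\cup B^1$ and $A^2\cup B^2$ are $\overline{2P_3}$-free with right-Sperner complements, or determine that $\overline{G}$ is not right-Sperner.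
   Context: Graphs are finite, simple, undirected. $2P_3$ is the disjoint union of two 3-vertex paths and $\overline{2P_3}$ its complement; $\overline{G}$ denotes the complement of $G$. A graph is cobipartite if its complement is bipartite. A labeled bigraph $(G,A,B)$ is a bipartite graph $G$ with bipartition $(A,B)$ into independent sets. It is right-Sperner if for all $u,v\in B$, $N(u)\subseteq N(v)$ implies $u=v$; a bigraph is right-Sperner if it has a bipartition making it right-Sperner. For a symmetric $m\times m$ matrix $M$ over $\{0,1,\ast\}$, an $M$-partition of $G$ is a partition of $V(G)$ into (possibly empty) parts $V_1,\dots,V_m$ such that distinct vertices in $V_i,V_j$ (possibly $i=j$) are adjacent if $M_{ij}=1$ and nonadjacent if $M_{ij}=0$ (no constraint if $\ast$). For $(a,b)\in\{0,1\}^2$, $M[a,b]=\begin{pmatrix} a&a&a&1&0\\ a&a&a&\ast&1\\ a&a&a&0&\ast\\ 1&\ast&0&b&b\\ 0&1&\ast&b&b\end{pmatrix}$. *)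

theory Defs
  imports Complex_Main "HOL-Library.Landau_Symbols"
begin

section \<open>Finite simple graphs\<close>

record 'a ugraph =
  verts :: "'a set"
  edges :: "'a set set"

definition simple_graph :: "'a ugraph \<Rightarrow> bool" where
  "simple_graph G \<longleftrightarrow> finite (verts G) \<and> (\<forall>e\<in>edges G. e \<subseteq> verts G \<and> card e = 2)"

definition adj :: "'a ugraph \<Rightarrow> 'a \<Rightarrow> 'a \<Rightarrow> bool" where
  "adj G u v \<longleftrightarrow> {u, v} \<in> edges G"

definition nbhd :: "'a ugraph \<Rightarrow> 'a \<Rightarrow> 'a set" where
  "nbhd G v = {u \<in> verts G. adj G u v}"

definition complement :: "'a ugraph \<Rightarrow> 'a ugraph" where
  "complement G = \<lparr>verts = verts G, edges = {e. e \<subseteq> verts G \<and> card e = 2} - edges G\<rparr>"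

definition induced :: "'a ugraph \<Rightarrow> 'a set \<Rightarrow> 'a ugraph" where
  "induced G S = \<lparr>verts = verts G \<inter> S, edges = {e \<in> edges G. e \<subseteq> S}\<rparr>"

definition isomorphic :: "'a ugraph \<Rightarrow> 'b ugraph \<Rightarrow> bool" where
  "isomorphic G H \<longleftrightarrow> (\<exists>f. bij_betw f (verts G) (verts H) \<and>
     (\<forall>u\<in>verts G. \<forall>v\<in>verts G. adj G u v \<longleftrightarrow> adj H (f u) (f v)))"

definition free_of :: "'a ugraph \<Rightarrow> 'b ugraph \<Rightarrow> bool" where
  "free_of G H \<longleftrightarrow> \<not> (\<exists>S \<subseteq> verts G. isomorphic (induced G S) H)"

definition path_graph :: "nat \<Rightarrow> nat ugraph" where
  "path_graph n = \<lparr>verts = {..<n}, edges = {{i, Suc i} | i. Suc i < n}\<rparr>"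

definition disjoint_union :: "'a ugraph \<Rightarrow> 'b ugraph \<Rightarrow> ('a + 'b) ugraph" where
  "disjoint_union G H = \<lparr>verts = verts G <+> verts H,
     edges = (\<lambda>e. Inl ` e) ` edges G \<union> (\<lambda>e. Inr ` e) ` edges H\<rparr>"

definition two_P3 :: "(nat + nat) ugraph" where
  "two_P3 = disjoint_union (path_graph 3) (path_graph 3)"

section \<open>Bigraphs\<close>

definition independent :: "'a ugraph \<Rightarrow> 'a set \<Rightarrow> bool" where
  "independent G S \<longleftrightarrow> (\<forall>u\<in>S. \<forall>v\<in>S. \<not> adj G u v)"

text \<open>Either side of a bipartition may be empty.\<close>

definition labeled_bigraph :: "'a ugraph \<Rightarrow> 'a set \<Rightarrow> 'a set \<Rightarrow> bool" where
  "labeled_bigraph G A B \<longleftrightarrow>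
     A \<union> B = verts G \<and> A \<inter> B = {} \<and> independent G A \<and> independent G B"

definition bipartite :: "'a ugraph \<Rightarrow> bool" where
  "bipartite G \<longleftrightarrow> (\<exists>A B. labeled_bigraph G A B)"

definition cobipartite :: "'a ugraph \<Rightarrow> bool" where
  "cobipartite G \<longleftrightarrow> bipartite (complement G)"

definition labeled_right_Sperner :: "'a ugraph \<Rightarrow> 'a set \<Rightarrow> 'a set \<Rightarrow> bool" where
  "labeled_right_Sperner G A B \<longleftrightarrow> labeled_bigraph G A B \<and>
     (\<forall>u\<in>B. \<forall>v\<in>B. nbhd G u \<subseteq> nbhd G v \<longrightarrow> u = v)"

definition right_Sperner :: "'a ugraph \<Rightarrow> bool" where
  "right_Sperner G \<longleftrightarrow> (\<exists>A B. labeled_right_Sperner G A B)"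

section \<open>Matrix partitions\<close>

datatype mat_entry = Zero | One | Star

text \<open>An \<open>m \<times> m\<close> matrix is the list of its \<open>m\<close> rows; the parts are listed in the order
  of the rows.\<close>

definition M_partition :: "mat_entry list list \<Rightarrow> 'a ugraph \<Rightarrow> 'a set list \<Rightarrow> bool" where
  "M_partition M G Vs \<longleftrightarrow> length Vs = length M \<and>
     \<Union> (set Vs) = verts G \<and>
     (\<forall>i<length M. \<forall>j<length M. i \<noteq> j \<longrightarrow> Vs ! i \<inter> Vs ! j = {}) \<and>
     (\<forall>i<length M. \<forall>j<length M. \<forall>u\<in>Vs ! i. \<forall>v\<in>Vs ! j. u \<noteq> v \<longrightarrow>
        (M ! i ! j = One \<longrightarrow> adj G u v) \<and> (M ! i ! j = Zero \<longrightarrow> \<not> adj G u v))"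

text \<open>The matrix \<open>M[a,b]\<close>, for \<open>a\<close> and \<open>b\<close> in \<open>{Zero, One}\<close>.\<close>

definition M_matrix :: "mat_entry \<Rightarrow> mat_entry \<Rightarrow> mat_entry list list" where
  "M_matrix a b =
    [[a,    a,    a,    One,  Zero],
     [a,    a,    a,    Star, One ],
     [a,    a,    a,    Zero, Star],
     [One,  Star, Zero, b,    b   ],
     [Zero, One,  Star, b,    b   ]]"

definition Sperner_decomposition ::
    "'a ugraph \<Rightarrow> 'a set \<Rightarrow> 'a set \<Rightarrow> 'a \<Rightarrow> 'a set \<Rightarrow> 'a set \<Rightarrow> 'a set \<Rightarrow> 'a set \<Rightarrow> bool" where
  "Sperner_decomposition G A B z A1 A2 B1 B2 \<longleftrightarrow>
     A = {z} \<union> A1 \<union> A2 \<and> B = B1 \<union> B2 \<and>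
     M_partition (M_matrix One One) G [{z}, A1, A2, B1, B2] \<and>
     free_of (induced G (A1 \<union> B1)) (complement two_P3) \<and>
     free_of (induced G (A2 \<union> B2)) (complement two_P3) \<and>
     right_Sperner (complement (induced G (A1 \<union> B1))) \<and>
     right_Sperner (complement (induced G (A2 \<union> B2)))"

section \<open>Random access machine programs with running times\<close>

text \<open>
  Running time is measured for structured programs on a word RAM. The input is a graph with
  vertices \<open>0, \<dots>, n - 1\<close>, given by \<open>n\<close> and read-only access to its adjacency matrix
  (\<open>Size\<close>, \<open>Query\<close>). The working memory consists of unbounded arrays of natural numbers; array
  names are literals in the program, so each program uses only finitely many arrays, and
  \<open>Read x i\<close> is the \<open>i\<close>-th entry of array \<open>x\<close>. Every operation has unit cost.

  The parameter \<open>W\<close> of the semantics is the largest number that fits in a memory cell: a program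
  that tries to store a larger one has no terminating execution. Within a single expression of a
  fixed program, intermediate values exceed \<open>W\<close>, \<open>n\<close> and the literals of the program by at most a
  constant factor.
\<close>

datatype aexp =
    Lit nat
  | Size
  | Query aexp aexp
  | Read nat aexp
  | Add aexp aexp
  | Sub aexp aexp

datatype bexp =
    Eq aexp aexp
  | Lt aexp aexp
  | Neg bexp
  | Conj bexp bexp

datatype com =
    Skip
  | Write nat aexp aexp
  | Seq com com
  | Cond bexp com com
  | Loop bexp com

type_synonym memory = "nat \<Rightarrow> nat \<Rightarrow> nat"

primrec aval :: "nat ugraph \<Rightarrow> aexp \<Rightarrow> memory \<Rightarrow> nat" where
  "aval G (Lit k) s = k"
| "aval G Size s = card (verts G)"
| "aval G (Query e f) s = (if adj G (aval G e s) (aval G f s) then 1 else 0)"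
| "aval G (Read x e) s = s x (aval G e s)"
| "aval G (Add e f) s = aval G e s + aval G f s"
| "aval G (Sub e f) s = aval G e s - aval G f s"

primrec bval :: "nat ugraph \<Rightarrow> bexp \<Rightarrow> memory \<Rightarrow> bool" where
  "bval G (Eq e f) s \<longleftrightarrow> aval G e s = aval G f s"
| "bval G (Lt e f) s \<longleftrightarrow> aval G e s < aval G f s"
| "bval G (Neg b) s \<longleftrightarrow> \<not> bval G b s"
| "bval G (Conj b c) s \<longleftrightarrow> bval G b s \<and> bval G c s"

primrec acost :: "aexp \<Rightarrow> nat" where
  "acost (Lit k) = 1"
| "acost Size = 1"
| "acost (Query e f) = 1 + acost e + acost f"
| "acost (Read x e) = 1 + acost e"
| "acost (Add e f) = 1 + acost e + acost f"
| "acost (Sub e f) = 1 + acost e + acost f"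

primrec bcost :: "bexp \<Rightarrow> nat" where
  "bcost (Eq e f) = 1 + acost e + acost f"
| "bcost (Lt e f) = 1 + acost e + acost f"
| "bcost (Neg b) = 1 + bcost b"
| "bcost (Conj b c) = 1 + bcost b + bcost c"

text \<open>\<open>exec W G c s t s'\<close>: on input \<open>G\<close> with memory \<open>s\<close>, program \<open>c\<close> terminates after exactly
  \<open>t\<close> steps with memory \<open>s'\<close>.\<close>

inductive exec :: "nat \<Rightarrow> nat ugraph \<Rightarrow> com \<Rightarrow> memory \<Rightarrow> nat \<Rightarrow> memory \<Rightarrow> bool"
  for W :: nat and G :: "nat ugraph" where
  Skip: "exec W G Skip s 1 s"
| Write: "aval G f s \<le> W \<Longrightarrow>
    exec W G (Write x e f) s (1 + acost e + acost f) (s(x := (s x)(aval G e s := aval G f s)))"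
| Seq: "exec W G c s t s' \<Longrightarrow> exec W G d s' t' s'' \<Longrightarrow> exec W G (Seq c d) s (t + t') s''"
| CondTrue: "bval G b s \<Longrightarrow> exec W G c s t s' \<Longrightarrow> exec W G (Cond b c d) s (bcost b + t) s'"
| CondFalse: "\<not> bval G b s \<Longrightarrow> exec W G d s t s' \<Longrightarrow> exec W G (Cond b c d) s (bcost b + t) s'"
| LoopFalse: "\<not> bval G b s \<Longrightarrow> exec W G (Loop b c) s (bcost b) s"
| LoopTrue: "bval G b s \<Longrightarrow> exec W G c s t s' \<Longrightarrow> exec W G (Loop b c) s' t' s'' \<Longrightarrow>
    exec W G (Loop b c) s (bcost b + t + t') s''"

inductive_cases SkipE: "exec W G Skip s t s'"
inductive_cases WriteE: "exec W G (Write x e f) s t s'"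
inductive_cases SeqE: "exec W G (Seq c d) s t s'"
inductive_cases CondE: "exec W G (Cond b c d) s t s'"
inductive_cases LoopE: "exec W G (Loop b c) s t s'"

lemma exec_deterministic:
  "exec W G c s t s' \<Longrightarrow> exec W G c s u s'' \<Longrightarrow> u = t \<and> s'' = s'"
proof (induction arbitrary: u s'' rule: exec.induct)
  case (Skip s)
  from Skip.prems show ?case by (rule SkipE) simp
next
  case (Write f s x e)
  from Write.prems show ?case by (rule WriteE) simp
next
  case (Seq c s t s' d t' r)
  from Seq.prems obtain v r' v' where "exec W G c s v r'" "exec W G d r' v' s''" "u = v + v'"
    by (rule SeqE)
  with Seq.IH show ?case by metis
next
  case (CondTrue b s c t s' d)
  from CondTrue.prems CondTrue.hyps obtain v where "exec W G c s v s''" "u = bcost b + v"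
    by (auto elim: CondE)
  with CondTrue.IH show ?case by metis
next
  case (CondFalse b s d t s' c)
  from CondFalse.prems CondFalse.hyps obtain v where "exec W G d s v s''" "u = bcost b + v"
    by (auto elim: CondE)
  with CondFalse.IH show ?case by metis
next
  case (LoopFalse b s c)
  from LoopFalse.prems LoopFalse.hyps show ?case by (auto elim: LoopE)
next
  case (LoopTrue b s c t s' t' r)
  from LoopTrue.prems LoopTrue.hyps obtain v r' v' where
    "exec W G c s v r'" "exec W G (Loop b c) r' v' s''" "u = bcost b + v + v'"
    by (auto elim: LoopE)
  with LoopTrue.IH show ?case by metis
qed

text \<open>
  Output convention: entry 0 of array 0 is 1 if the program returns a decomposition and 0 if it
  reports that there is none. In the former case, array 1 maps each vertex to the index of its
  part, where the parts \<open>{z}, A1, A2, B1, B2\<close> have the indices \<open>0, \<dots>, 4\<close>.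
\<close>

definition output_part :: "nat ugraph \<Rightarrow> memory \<Rightarrow> nat \<Rightarrow> nat set" where
  "output_part G s i = {v \<in> verts G. s 1 v = i}"

definition correct_output :: "nat ugraph \<Rightarrow> memory \<Rightarrow> bool" where
  "correct_output G s \<longleftrightarrow>
     (s 0 0 = 1 \<and>
       (\<exists>z A1 A2 B1 B2 A B.
          {z} = output_part G s 0 \<and> A1 = output_part G s 1 \<and> A2 = output_part G s 2 \<and>
          B1 = output_part G s 3 \<and> B2 = output_part G s 4 \<and>
          A = {z} \<union> A1 \<union> A2 \<and> B = B1 \<union> B2 \<and>
          labeled_right_Sperner (complement G) A B \<and>
          Sperner_decomposition G A B z A1 A2 B1 B2)) \<or>
     (s 0 0 = 0 \<and> \<not> right_Sperner (complement G))"

end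

theory Submission
  imports Defs
begin

text \<open>
  Let \<open>H\<close> be the complement of \<open>G\<close>. As \<open>H\<close> has no induced \<open>2P\<^sub>3\<close>, of any two vertices of \<open>B\<close> one has
  at most one neighbour that the other lacks. Take \<open>u\<close> and \<open>v\<close> in \<open>B\<close> of minimum and maximum degree
  in \<open>H\<close>, and \<open>z\<close> in \<open>N(u) - N(v)\<close>. Comparing degrees shows that \<open>N(e) - N(g) = {z}\<close> whenever
  \<open>z \<in> N(e)\<close> and \<open>z \<notin> N(g)\<close>. Hence for every other \<open>a\<close> in \<open>A\<close>, either \<open>N(a)\<close> and \<open>N(z)\<close> are
  disjoint (these form \<open>A\<^sup>1\<close>) or they cover \<open>B\<close> (these form \<open>A\<^sup>2\<close>), and \<open>B\<^sup>2 = N(z)\<close>.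

  For the algorithm, at most one component of \<open>H\<close> has more than two vertices, because of \<open>2P\<^sub>3\<close>.
  Isolated vertices can be put into \<open>A\<close>, components with two vertices can be oriented arbitrarily,
  so only the two orientations of the large component have to be tried. Its vertices of degree at
  least two that lie on the same side have a common neighbour, so that everything
  can be expressed by first-order formulas. Evaluating such a formula by nested loops takes time
  \<open>O(n\<^sup>k)\<close> for quantifier depth \<open>k\<close>, and depth two suffices besides the vertex that is labelled.
\<close>

section \<open>Nearly nested antichains\<close>

definition antichain_on :: "('b \<Rightarrow> 'a set) \<Rightarrow> 'b set \<Rightarrow> bool" where
  "antichain_on N B \<longleftrightarrow> (\<forall>u\<in>B. \<forall>v\<in>B. N u \<subseteq> N v \<longrightarrow> u = v)"

definition nearly_nested :: "('b \<Rightarrow> 'a set) \<Rightarrow> 'b set \<Rightarrow> bool" where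
  "nearly_nested N B \<longleftrightarrow> (\<forall>u\<in>B. \<forall>v\<in>B. card (N u - N v) \<le> 1 \<or> card (N v - N u) \<le> 1)"

text \<open>Both differences arise by removing the same intersection, so the smaller set leaves the
  smaller difference. Near nestedness bounds that one by 1, and \<open>z\<close> shows that it is
  not empty.\<close>

lemma nearly_nested_diff_eq:
  assumes "nearly_nested N B" and "u \<in> B" "v \<in> B" and "finite (N u)" "finite (N v)"
    and "z \<in> N u - N v" and "card (N u) \<le> card (N v)"
  shows "N u - N v = {z}"
proof -
  have "card (N u) = card (N u - N v) + card (N u \<inter> N v)"
    using card_Int_Diff[OF assms(4), of "N v"] by simp
  moreover have "card (N v) = card (N v - N u) + card (N u \<inter> N v)"
    using card_Int_Diff[OF assms(5), of "N u"] by (simp add: Int_commute)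
  moreover have "card (N u - N v) \<le> 1 \<or> card (N v - N u) \<le> 1"
    using assms by (auto simp: nearly_nested_def)
  ultimately have "card (N u - N v) \<le> 1"
    using assms(7) by linarith
  moreover have "card (N u - N v) \<ge> 1"
    using assms(4,6) by (metis One_nat_def Suc_leI card_gt_0_iff empty_iff finite_Diff)
  ultimately have "card (N u - N v) = 1" by simp
  with assms(6) show ?thesis by (metis card_1_singletonE singletonD)
qed

text \<open>A bad pair \<open>e\<close>, \<open>g\<close> must satisfy card (N g) < card (N e). Then
  N g - N e is a singleton, but the extremal choice of \<open>u\<close> and \<open>v\<close>
  produces two distinct elements of it: one inside \<open>N v\<close> and one outside.\<close>

lemma exists_separating_element:
  assumes "finite B" and fin: "\<And>u. u \<in> B \<Longrightarrow> finite (N u)"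
    and sub: "\<And>u. u \<in> B \<Longrightarrow> N u \<subseteq> A" and "A \<noteq> {}"
    and anti: "antichain_on N B" and near: "nearly_nested N B"
  shows "\<exists>z\<in>A. \<forall>e\<in>B. \<forall>g\<in>B. z \<in> N e \<and> z \<notin> N g \<longrightarrow> N e - N g = {z}"
proof (cases "\<exists>u\<in>B. \<exists>v\<in>B. u \<noteq> v")
  case False
  \<comment> \<open>Here \<open>B\<close> has at most one element, so e = g and the premise is
    contradictory; any element of \<open>A\<close> will do.\<close>
  then have "z \<in> N e \<and> z \<notin> N g \<longrightarrow> N e - N g = {z}" if "e \<in> B" "g \<in> B" for z e g
    using that by metis
  with \<open>A \<noteq> {}\<close> show ?thesis by blast
next
  case True
  then have "B \<noteq> {}" by blast
  have diff: "\<exists>x. x \<in> N e - N g" if "e \<in> B" "g \<in> B" "e \<noteq> g" for e g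
    using anti that unfolding antichain_on_def by blast
  have one: "N e - N g = {x}"
    if "e \<in> B" "g \<in> B" "x \<in> N e - N g" "card (N e) \<le> card (N g)" for e g x
    using nearly_nested_diff_eq[OF near that(1,2) fin fin that(3,4)] that(1,2) by blast
  obtain u where u: "u \<in> B" and umin: "\<And>e. e \<in> B \<Longrightarrow> card (N u) \<le> card (N e)"
    using \<open>B \<noteq> {}\<close> ex_has_least_nat[of "\<lambda>u. u \<in> B" _ "\<lambda>u. card (N u)"] by blast
  obtain v where v: "v \<in> B" "v \<noteq> u" and vmax: "\<And>e. e \<in> B \<Longrightarrow> card (N e) \<le> card (N v)"
  proof -
    have "Max ((\<lambda>e. card (N e)) ` B) \<in> (\<lambda>e. card (N e)) ` B"
      using \<open>finite B\<close> \<open>B \<noteq> {}\<close> by (intro Max_in) auto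
    then obtain m where "m \<in> B" "card (N m) = Max ((\<lambda>e. card (N e)) ` B)" by force
    then have m: "m \<in> B" "\<And>e. e \<in> B \<Longrightarrow> card (N e) \<le> card (N m)"
      using \<open>finite B\<close> by auto
    show thesis
    proof (cases "m = u")
      case False
      with m that show thesis by blast
    next
      \<comment> \<open>If the maximum is attained at \<open>u\<close>, then minimum and maximum
        coincide and every other element of \<open>B\<close> is maximal as well.\<close>
      case eq: True
      obtain w where "w \<in> B" "w \<noteq> u" using True u by metis
      moreover have "card (N e) \<le> card (N w)" if "e \<in> B" for e
        using m(2)[OF that] umin[OF \<open>w \<in> B\<close>] eq by simp
      ultimately show thesis using that by blast
    qed
  qed
  obtain z where z: "z \<in> N u - N v" using diff u v by blast
  have "N e - N g = {z}" if e: "e \<in> B" "z \<in> N e" and g: "g \<in> B" "z \<notin> N g" for e g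
  proof (rule ccontr)
    assume neq: "N e - N g \<noteq> {z}"
    then have lt: "card (N g) < card (N e)"
      using one[OF e(1) g(1), of z] e g by force
    have "e \<noteq> g" "g \<noteq> v" "e \<noteq> u"
      using e g vmax[of e] lt umin[of g] by auto
    have ev: "N e - N v = {z}" using one[OF e(1) v(1) _ vmax[OF e(1)]] e z by blast
    have ug: "N u - N g = {z}" using one[OF u g(1) _ umin[OF g(1)]] g z by blast
    \<comment> \<open>As \<open>z\<close> lies in \<open>N e\<close> and not in \<open>N g\<close>,
      neither \<open>p\<close> nor \<open>q\<close> is \<open>z\<close>. So the singleton
      differences \<open>N u - N g\<close> and \<open>N u - N v\<close> put \<open>p\<close> into
      \<open>N g\<close> and \<open>N v\<close>, and \<open>N e - N v\<close> keeps \<open>q\<close>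
      out of \<open>N e\<close>.\<close>
    obtain p where p: "p \<in> N u" "p \<notin> N e" using diff[OF u e(1)] \<open>e \<noteq> u\<close> by blast
    have pg: "p \<in> N g - N e" using p ug e(2) by (metis DiffI singletonD)
    have pv: "p \<in> N v" using p one[OF u v(1) z umin[OF v(1)]] e(2) by (metis DiffI singletonD)
    obtain q where q: "q \<in> N g" "q \<notin> N v" using diff[OF g(1) v(1)] \<open>g \<noteq> v\<close> by blast
    have "q \<in> N g - N e" using q ev g(2) by (metis DiffI singletonD)
    moreover have "N g - N e = {p}" using one[OF g(1) e(1) pg] lt by simp
    ultimately show False using q pv by (metis singletonD)
  qed
  moreover have "z \<in> A" using z sub[OF u] by blast
  ultimately show ?thesis by blast
qed

section \<open>Complements, induced subgraphs and the forbidden subgraph\<close>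

lemma adj_commute: "adj G u v \<longleftrightarrow> adj G v u"
  by (simp add: adj_def insert_commute)

lemma adj_complement:
  "adj (complement G) u v \<longleftrightarrow> u \<in> verts G \<and> v \<in> verts G \<and> u \<noteq> v \<and> \<not> adj G u v"
  by (auto simp: adj_def complement_def card_2_iff doubleton_eq_iff)

lemma verts_complement [simp]: "verts (complement G) = verts G"
  by (simp add: complement_def)

lemma verts_induced [simp]: "verts (induced G S) = verts G \<inter> S"
  by (simp add: induced_def)

lemma adj_induced: "adj (induced G S) u v \<longleftrightarrow> adj G u v \<and> u \<in> S \<and> v \<in> S"
  by (auto simp: adj_def induced_def)

lemma simple_graph_not_adj_self:
  assumes "simple_graph G"
  shows "\<not> adj G u u"
  using assms by (auto simp: simple_graph_def adj_def)

lemma nbhd_complement_induced: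
  assumes "S \<subseteq> verts G" "v \<in> S"
  shows "nbhd (complement (induced G S)) v = nbhd (complement G) v \<inter> S"
  using assms by (auto simp: nbhd_def adj_complement adj_induced)

lemma free_of_induced:
  assumes "free_of G F"
  shows "free_of (induced G S) F"
proof -
  have "induced (induced G S) T = induced G T" if "T \<subseteq> verts (induced G S)" for T
    using that by (auto simp: induced_def)
  with assms show ?thesis by (auto simp: free_of_def)
qed

lemma adj_two_P3:
  "adj two_P3 (Inl i) (Inl j) \<longleftrightarrow> (i = 1 \<and> j \<in> {0, 2}) \<or> (j = 1 \<and> i \<in> {0, 2})"
  "adj two_P3 (Inr i) (Inr j) \<longleftrightarrow> (i = 1 \<and> j \<in> {0, 2}) \<or> (j = 1 \<and> i \<in> {0, 2})"
  "\<not> adj two_P3 (Inl i) (Inr j)" "\<not> adj two_P3 (Inr i) (Inl j)"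
proof -
  have P3: "edges (path_graph 3) = {{0, 1}, {1, 2}}"
    by (auto simp: path_graph_def less_Suc_eq numeral_3_eq_3)
  show "adj two_P3 (Inl i) (Inl j) \<longleftrightarrow> (i = 1 \<and> j \<in> {0, 2}) \<or> (j = 1 \<and> i \<in> {0, 2})"
    "adj two_P3 (Inr i) (Inr j) \<longleftrightarrow> (i = 1 \<and> j \<in> {0, 2}) \<or> (j = 1 \<and> i \<in> {0, 2})"
    "\<not> adj two_P3 (Inl i) (Inr j)" "\<not> adj two_P3 (Inr i) (Inl j)"
    by (auto simp: adj_def two_P3_def disjoint_union_def P3 doubleton_eq_iff)
qed

lemma verts_two_P3: "verts two_P3 = {Inl 0, Inl 1, Inl 2, Inr 0, Inr 1, Inr 2}"
  by (auto simp: two_P3_def disjoint_union_def path_graph_def less_Suc_eq numeral_3_eq_3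
      numeral_2_eq_2)

text \<open>The paths x-c-x' and y-d-y' form an induced copy of \<open>two_P3\<close> in the
  complement: the centres lie in \<open>B\<close> and hence the leaves in \<open>A\<close>, so
  independence of the sides and the listed non-edges exclude every further edge.\<close>

lemma two_stars_not_free:
  fixes G :: "'a ugraph"
  defines "E \<equiv> adj (complement G)"
  assumes G: "simple_graph G" "labeled_bigraph (complement G) A B"
    and c: "c \<in> B" "d \<in> B"
    and x: "E c x" "E c x'" "\<not> E d x" "\<not> E d x'" "x \<noteq> x'"
    and y: "E d y" "E d y'" "\<not> E c y" "\<not> E c y'" "y \<noteq> y'"
  shows "\<not> free_of G (complement two_P3)"
proof -
  have V: "c \<in> verts G" "d \<in> verts G" "x \<in> verts G" "x' \<in> verts G" "y \<in> verts G" "y' \<in> verts G"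
    using x y by (auto simp: E_def adj_complement)
  have A: "x \<in> A" "x' \<in> A" "y \<in> A" "y' \<in> A"
    using G(2) V c x y by (auto simp: labeled_bigraph_def independent_def E_def)
  then have nA: "\<not> E u v" if "u \<in> {x, x', y, y'}" "v \<in> {x, x', y, y'}" for u v
    using that G(2) by (auto simp: labeled_bigraph_def independent_def E_def)
  have nB: "\<not> E u v" if "u \<in> {c, d}" "v \<in> {c, d}" for u v
    using that c G(2) by (auto simp: labeled_bigraph_def independent_def E_def)
  have dist: "distinct [x, c, x', y, d, y']"
    using A c x y G(2) by (auto simp: labeled_bigraph_def)
  define h where "h = case_sum (\<lambda>i::nat. if i = 0 then x else if i = 1 then c else x')
    (\<lambda>i::nat. if i = 0 then y else if i = 1 then d else y')"
  define S where "S = {x, c, x', y, d, y'}"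
  have bij: "bij_betw h (verts two_P3) S"
    using dist by (auto simp: verts_two_P3 h_def S_def bij_betw_def inj_on_def)
  have comm: "E u v = E v u" for u v by (simp add: E_def adj_commute)
  \<comment> \<open>All 36 ordered pairs are checked: pairs within a side by \<open>nA\<close> and
    \<open>nB\<close>, the others by the table.\<close>
  have edge: "adj two_P3 p q = E (h p) (h q)" if "p \<in> verts two_P3" "q \<in> verts two_P3" for p q
  proof -
    have "E x c" "E x' c" "E y d" "E y' d" "\<not> E x d" "\<not> E x' d" "\<not> E y c" "\<not> E y' c"
      using x y comm by blast+
    note table = this x(1-4) y(1-4)
    show ?thesis
      using that unfolding verts_two_P3
      by (elim insertE emptyE; hypsubst; simp add: adj_two_P3 h_def table nA nB)
  qed
  have SV: "S \<subseteq> verts G" using V by (auto simp: S_def)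
  \<comment> \<open>\<open>isomorphic\<close> asks for a map from the induced subgraph to the
    pattern, which is the inverse of \<open>h\<close>.\<close>
  let ?f = "inv_into (verts two_P3) h"
  have "bij_betw ?f S (verts two_P3)" using bij by (rule bij_betw_inv_into)
  moreover have "adj (induced G S) u v = adj (complement two_P3) (?f u) (?f v)"
    if u: "u \<in> S" and v: "v \<in> S" for u v
  proof -
    have fu: "?f u \<in> verts two_P3" "h (?f u) = u" and fv: "?f v \<in> verts two_P3" "h (?f v) = v"
      using bij u v by (auto simp: bij_betw_def inv_into_into f_inv_into_f)
    then have eq: "?f u = ?f v \<longleftrightarrow> u = v" by metis
    have "adj (complement two_P3) (?f u) (?f v) \<longleftrightarrow> u \<noteq> v \<and> \<not> E u v"
      using edge[OF fu(1) fv(1)] fu fv eq by (simp add: adj_complement)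
    also have "\<dots> \<longleftrightarrow> adj G u v"
      using SV u v simple_graph_not_adj_self[OF G(1)] by (auto simp: E_def adj_complement)
    finally show ?thesis using u v by (simp add: adj_induced)
  qed
  moreover have "verts (induced G S) = S" using SV by auto
  ultimately have "isomorphic (induced G S) (complement two_P3)"
    unfolding isomorphic_def by (intro exI[of _ ?f]) simp
  with SV show ?thesis by (auto simp: free_of_def)
qed

lemma finite_nbhd: "simple_graph G \<Longrightarrow> finite (nbhd (complement G) v)"
  by (simp add: simple_graph_def nbhd_def)

lemma nearly_nested_nbhd:
  assumes "simple_graph G" "labeled_bigraph (complement G) A B"
    and free: "free_of G (complement two_P3)"
  shows "nearly_nested (nbhd (complement G)) B"
  unfolding nearly_nested_def
proof (intro ballI, rule ccontr)
  fix c d assume B: "c \<in> B" "d \<in> B"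
    and no: "\<not> (card (nbhd (complement G) c - nbhd (complement G) d) \<le> 1 \<or>
      card (nbhd (complement G) d - nbhd (complement G) c) \<le> 1)"
  have two: "\<exists>x\<in>X. \<exists>y\<in>X. x \<noteq> y" if "\<not> card X \<le> 1" for X :: "'a set"
    using that by (metis One_nat_def card_le_Suc0_iff_eq card.infinite zero_le_one)
  from no two obtain x x' y y' where
    "x \<in> nbhd (complement G) c - nbhd (complement G) d"
    "x' \<in> nbhd (complement G) c - nbhd (complement G) d" "x \<noteq> x'"
    "y \<in> nbhd (complement G) d - nbhd (complement G) c"
    "y' \<in> nbhd (complement G) d - nbhd (complement G) c" "y \<noteq> y'"
    by (metis (no_types, lifting))
  then show False
    using two_stars_not_free[OF assms(1,2) B, of x x' y y'] free
    by (auto simp: nbhd_def adj_commute)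
qed

section \<open>The decomposition\<close>

lemma right_Sperner_induced:
  assumes "labeled_bigraph (complement G) A B" and "A' \<subseteq> A" "B' \<subseteq> B"
    and anti: "\<And>u v. \<lbrakk>u \<in> B'; v \<in> B'; nbhd (complement G) u \<inter> A' \<subseteq> nbhd (complement G) v \<inter> A'\<rbrakk> \<Longrightarrow> u = v"
  shows "right_Sperner (complement (induced G (A' \<union> B')))"
proof -
  have sub: "A' \<union> B' \<subseteq> verts G" using assms by (auto simp: labeled_bigraph_def)
  have indep: "independent (complement (induced G (A' \<union> B'))) X"
    if "independent (complement G) Y" "X \<subseteq> Y" "X \<subseteq> A' \<union> B'" for X Y
    unfolding independent_def
  proof (intro ballI)
    fix u v assume "u \<in> X" "v \<in> X"
    moreover from this have "\<not> adj (complement G) u v"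
      using that by (auto simp: independent_def)
    ultimately show "\<not> adj (complement (induced G (A' \<union> B'))) u v"
      using that(3) by (auto simp: adj_complement adj_induced)
  qed
  have "labeled_bigraph (complement (induced G (A' \<union> B'))) A' B'"
    unfolding labeled_bigraph_def
    using assms(1-3) sub indep[of A A'] indep[of B B'] by (auto simp: labeled_bigraph_def)
  moreover have "u = v" if "u \<in> B'" "v \<in> B'"
    "nbhd (complement (induced G (A' \<union> B'))) u \<subseteq> nbhd (complement (induced G (A' \<union> B'))) v" for u v
    using that anti[of u v] nbhd_complement_induced[OF sub] by auto
  ultimately show ?thesis
    unfolding right_Sperner_def labeled_right_Sperner_def by blast
qed

text \<open>The entries \<open>One\<close> inside the blocks of \<open>A\<close> and of
  \<open>B\<close> follow from independence in the complement. Of the six entries between the sides,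
  two are \<open>Star\<close>, and each of the other four has its own assumption, stated for the
  complement.\<close>

lemma M_partitionI:
  fixes G :: "'a ugraph"
  defines "E \<equiv> adj (complement G)"
  assumes G: "labeled_bigraph (complement G) A B"
    and parts: "A = {z} \<union> A1 \<union> A2" "B = B1 \<union> B2" "z \<notin> A1 \<union> A2" "A1 \<inter> A2 = {}" "B1 \<inter> B2 = {}"
    and z: "\<And>b. b \<in> B1 \<Longrightarrow> \<not> E z b" "\<And>b. b \<in> B2 \<Longrightarrow> E z b"
    and A1: "\<And>a b. \<lbrakk>a \<in> A1; b \<in> B2\<rbrakk> \<Longrightarrow> \<not> E a b"
    and A2: "\<And>a b. \<lbrakk>a \<in> A2; b \<in> B1\<rbrakk> \<Longrightarrow> E a b"
  shows "M_partition (M_matrix One One) G [{z}, A1, A2, B1, B2]"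
proof -
  have V: "A \<union> B = verts G" and disj: "A \<inter> B = {}"
    using G by (auto simp: labeled_bigraph_def)
  have same: "adj G u v" if "u \<in> A \<and> v \<in> A \<or> u \<in> B \<and> v \<in> B" "u \<noteq> v" for u v
  proof -
    have "\<not> adj (complement G) u v" and "u \<in> verts G" "v \<in> verts G"
      using that G V by (auto simp: labeled_bigraph_def independent_def)
    with \<open>u \<noteq> v\<close> show ?thesis by (simp add: adj_complement)
  qed
  have other: "adj G u v \<longleftrightarrow> \<not> E u v" "adj G v u \<longleftrightarrow> \<not> E u v" if "u \<in> A" "v \<in> B" for u v
    using that V disj adj_commute[of G] by (auto simp: E_def adj_complement)
  have inA: "z \<in> A" "A1 \<subseteq> A" "A2 \<subseteq> A" and inB: "B1 \<subseteq> B" "B2 \<subseteq> B"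
    using parts by auto
  have zB1: "adj G z b \<and> adj G b z" if "b \<in> B1" for b
    using other[of z b] z(1)[OF that] subsetD[OF inB(1) that] inA(1) by simp
  have zB2: "\<not> adj G z b \<and> \<not> adj G b z" if "b \<in> B2" for b
    using other[of z b] z(2)[OF that] subsetD[OF inB(2) that] inA(1) by simp
  have A1B2: "adj G a b \<and> adj G b a" if "a \<in> A1" "b \<in> B2" for a b
    using other[of a b] A1[OF that] subsetD[OF inA(2) that(1)] subsetD[OF inB(2) that(2)] by simp
  have A2B1: "\<not> adj G a b \<and> \<not> adj G b a" if "a \<in> A2" "b \<in> B1" for a b
    using other[of a b] A2[OF that] subsetD[OF inA(3) that(1)] subsetD[OF inB(1) that(2)] by simp
  have disjoint: "z \<notin> A1" "z \<notin> A2" "z \<notin> B1" "z \<notin> B2" "A1 \<inter> B1 = {}" "A1 \<inter> B2 = {}"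
    "A2 \<inter> B1 = {}" "A2 \<inter> B2 = {}" "B1 \<inter> A1 = {}" "B1 \<inter> A2 = {}" "B2 \<inter> A1 = {}"
    "B2 \<inter> A2 = {}" "A2 \<inter> A1 = {}" "B2 \<inter> B1 = {}"
    using parts(3-5) disj inA inB by auto
  have "\<forall>i<5. \<forall>j<5. i \<noteq> j \<longrightarrow> [{z}, A1, A2, B1, B2] ! i \<inter> [{z}, A1, A2, B1, B2] ! j = {}"
    by (simp add: All_less_Suc numeral_nat disjoint parts(4,5))
  moreover have "\<Union> (set [{z}, A1, A2, B1, B2]) = verts G"
    using V parts(1,2) by auto
  moreover have "\<forall>i<5. \<forall>j<5. \<forall>u\<in>[{z}, A1, A2, B1, B2] ! i. \<forall>v\<in>[{z}, A1, A2, B1, B2] ! j. u \<noteq> v \<longrightarrow>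
    (M_matrix One One ! i ! j = One \<longrightarrow> adj G u v) \<and> (M_matrix One One ! i ! j = Zero \<longrightarrow> \<not> adj G u v)"
    unfolding M_matrix_def using same zB1 zB2 A1B2 A2B1 inA inB
    by (simp add: All_less_Suc numeral_nat subset_iff)
  moreover have "length (M_matrix One One) = 5" by (simp add: M_matrix_def)
  ultimately show ?thesis
    unfolding M_partition_def by simp
qed

definition splits :: "'a ugraph \<Rightarrow> 'a set \<Rightarrow> 'a set \<Rightarrow> 'a \<Rightarrow> bool" where
  "splits H A B z \<longleftrightarrow> (\<forall>a\<in>A. a = z \<or> (\<forall>b\<in>B. \<not> (adj H a b \<and> adj H z b)) \<or>
     (\<forall>b\<in>B. adj H a b \<or> adj H z b))"

text \<open>A vertex \<open>a\<close> violating \<open>splits\<close> has a common neighbour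
  \<open>e\<close> with \<open>z\<close> in \<open>B\<close>, and some \<open>g\<close> in
  \<open>B\<close> is adjacent to neither. Then \<open>a\<close> is a second element of
  \<open>N e - N g\<close>, against the choice of \<open>z\<close>.\<close>

lemma exists_splits:
  assumes G: "simple_graph G" "free_of G (complement two_P3)"
    and S: "labeled_right_Sperner (complement G) A B" and "A \<noteq> {}"
  shows "\<exists>z\<in>A. splits (complement G) A B z"
proof -
  let ?N = "nbhd (complement G)"
  have bi: "labeled_bigraph (complement G) A B" and anti: "antichain_on ?N B"
    using S by (auto simp: labeled_right_Sperner_def antichain_on_def)
  have "finite B" using bi G(1) unfolding labeled_bigraph_def simple_graph_def
    by (metis finite_Un verts_complement)
  moreover have "?N u \<subseteq> A" if "u \<in> B" for u
    using bi that by (auto simp: labeled_bigraph_def independent_def nbhd_def adj_commute)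
  ultimately obtain z where "z \<in> A"
    and z: "\<And>e g. \<lbrakk>e \<in> B; g \<in> B; z \<in> ?N e; z \<notin> ?N g\<rbrakk> \<Longrightarrow> ?N e - ?N g = {z}"
    using exists_separating_element[of B ?N A, OF _ finite_nbhd[OF G(1)] _ \<open>A \<noteq> {}\<close> anti
        nearly_nested_nbhd[OF G(1) bi G(2)]] by blast
  have "splits (complement G) A B z"
    unfolding splits_def
  proof (intro ballI, rule ccontr)
    fix a assume "a \<in> A" and "\<not> (a = z \<or> (\<forall>b\<in>B. \<not> (adj (complement G) a b \<and> adj (complement G) z b)) \<or>
     (\<forall>b\<in>B. adj (complement G) a b \<or> adj (complement G) z b))"
    then obtain e g where "a \<noteq> z" and eg: "e \<in> B" "g \<in> B" "adj (complement G) a e" "adj (complement G) z e"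
      "\<not> adj (complement G) a g" "\<not> adj (complement G) z g" by blast
    moreover from eg have "z \<in> ?N e" "z \<notin> ?N g" "a \<in> ?N e - ?N g"
      by (auto simp: nbhd_def adj_complement)
    ultimately show False using z[of e g] by blast
  qed
  with \<open>z \<in> A\<close> show ?thesis by blast
qed

text \<open>A vertex satisfying both alternatives of \<open>splits\<close> goes to
  \<open>A1\<close>. The antichain property is inherited because the rest of \<open>A\<close> cannot
  tell vertices apart: \<open>A2\<close> is completely joined to \<open>B1\<close> in the complement
  and \<open>z\<close> has no neighbour there, while for \<open>B2\<close> the vertex
  \<open>z\<close> is joined to everything and \<open>A1\<close> to nothing.\<close>

lemma Sperner_decompositionI:
  fixes G :: "'a ugraph"
  defines "E \<equiv> adj (complement G)"
  assumes free: "free_of G (complement two_P3)" 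
    and S: "labeled_right_Sperner (complement G) A B"
    and z: "z \<in> A" "splits (complement G) A B z"
    and A1: "A1 = {a \<in> A - {z}. \<forall>b\<in>B. \<not> (E a b \<and> E z b)}"
    and A2: "A2 = A - {z} - A1"
    and B1: "B1 = {b \<in> B. \<not> E z b}" and B2: "B2 = {b \<in> B. E z b}"
  shows "Sperner_decomposition G A B z A1 A2 B1 B2"
proof -
  have bi: "labeled_bigraph (complement G) A B"
    and anti: "\<And>u v. \<lbrakk>u \<in> B; v \<in> B; nbhd (complement G) u \<subseteq> nbhd (complement G) v\<rbrakk> \<Longrightarrow> u = v"
    using S by (auto simp: labeled_right_Sperner_def)
  have parts: "A = {z} \<union> A1 \<union> A2" "B = B1 \<union> B2" "z \<notin> A1 \<union> A2" "A1 \<inter> A2 = {}" "B1 \<inter> B2 = {}"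
    using z unfolding A1 A2 B1 B2 by blast+
  have a1: "\<not> E a b" if "a \<in> A1" "b \<in> B2" for a b
    using that unfolding A1 B2 by blast
  have a2: "E a b" if "a \<in> A2" "b \<in> B1" for a b
    using that z(2) unfolding A1 A2 B1 splits_def E_def by blast
  have N: "nbhd (complement G) u = {a \<in> A. E a u}" if "u \<in> B" for u
    using that bi by (auto simp: nbhd_def E_def labeled_bigraph_def independent_def adj_commute)
  have "right_Sperner (complement (induced G (A1 \<union> B1)))"
  proof (rule right_Sperner_induced[OF bi])
    fix u v assume uv: "u \<in> B1" "v \<in> B1"
      and sub: "nbhd (complement G) u \<inter> A1 \<subseteq> nbhd (complement G) v \<inter> A1"
    have B: "u \<in> B" "v \<in> B" using uv parts by auto
    have "E a v" if "a \<in> A" "E a u" for a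
      using that sub a2[OF _ uv(2)] uv parts(1) unfolding B1 N[OF B(1)] N[OF B(2)] by blast
    then show "u = v" using anti[OF B] N[OF B(1)] N[OF B(2)] by blast
  qed (use parts in auto)
  moreover have "right_Sperner (complement (induced G (A2 \<union> B2)))"
  proof (rule right_Sperner_induced[OF bi])
    fix u v assume uv: "u \<in> B2" "v \<in> B2"
      and sub: "nbhd (complement G) u \<inter> A2 \<subseteq> nbhd (complement G) v \<inter> A2"
    have B: "u \<in> B" "v \<in> B" using uv parts by auto
    have "E a v" if "a \<in> A" "E a u" for a
      using that sub a1[OF _ uv(1)] uv parts(1) unfolding B2 N[OF B(1)] N[OF B(2)] by blast
    then show "u = v" using anti[OF B] N[OF B(1)] N[OF B(2)] by blast
  qed (use parts in auto)
  moreover have "M_partition (M_matrix One One) G [{z}, A1, A2, B1, B2]"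
  proof (rule M_partitionI[OF bi parts])
    show "\<not> adj (complement G) z b" if "b \<in> B1" for b using that by (simp add: B1 E_def)
    show "adj (complement G) z b" if "b \<in> B2" for b using that by (simp add: B2 E_def)
  qed (use a1 a2 in \<open>simp_all add: E_def\<close>)
  ultimately show ?thesis
    unfolding Sperner_decomposition_def
    by (intro conjI parts(1,2) free_of_induced free)
qed

lemma exists_Sperner_decomposition:
  assumes "simple_graph G" "card (verts G) \<ge> 2" "free_of G (complement two_P3)"
    and S: "labeled_right_Sperner (complement G) A B"
  shows "\<exists>z A1 A2 B1 B2. Sperner_decomposition G A B z A1 A2 B1 B2"
proof -
  \<comment> \<open>With \<open>A\<close> empty all neighbourhoods are empty, and an antichain of
    equal sets has at most one member.\<close>
  have "A \<noteq> {}"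
  proof
    assume "A = {}"
    with S have "B = verts G" and ind: "independent (complement G) B"
      and anti: "\<And>u v. \<lbrakk>u \<in> B; v \<in> B; nbhd (complement G) u \<subseteq> nbhd (complement G) v\<rbrakk> \<Longrightarrow> u = v"
      by (auto simp: labeled_right_Sperner_def labeled_bigraph_def)
    then have "nbhd (complement G) u = {}" if "u \<in> B" for u
      using that by (auto simp: independent_def nbhd_def)
    with anti \<open>B = verts G\<close> have "\<forall>u\<in>verts G. \<forall>v\<in>verts G. u = v"
      by blast
    then have "card (verts G) \<le> 1"
      using card_le_Suc0_iff_eq[of "verts G"] assms(1) by (auto simp: simple_graph_def)
    with assms(2) show False by simp
  qed
  then obtain z where "z \<in> A" "splits (complement G) A B z"
    using exists_splits[OF assms(1,3) S] by blast
  from Sperner_decompositionI[OF assms(3) S this refl refl refl refl] show ?thesis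
    by blast
qed

section \<open>First-order queries on a random access machine\<close>

text \<open>Variables are de Bruijn levels: a quantifier below \<open>d\<close> others binds the variable \<open>d\<close>.
  \<open>Nb\<close> is adjacency in the complement of the input, and \<open>Lab x i\<close> tests whether array \<open>x\<close> has a
  nonzero entry at the variable \<open>i\<close>.\<close>

datatype query =
    Nb nat nat
  | Same nat nat
  | Less nat nat
  | Lab nat nat
  | NotQ query
  | AndQ query query
  | ExQ query

primrec sat :: "nat ugraph \<Rightarrow> memory \<Rightarrow> nat \<Rightarrow> (nat \<Rightarrow> nat) \<Rightarrow> query \<Rightarrow> bool" where
  "sat G m d e (Nb i j) \<longleftrightarrow> adj (complement G) (e i) (e j)"
| "sat G m d e (Same i j) \<longleftrightarrow> e i = e j"
| "sat G m d e (Less i j) \<longleftrightarrow> e i < e j"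
| "sat G m d e (Lab x i) \<longleftrightarrow> m x (e i) \<noteq> 0"
| "sat G m d e (NotQ f) \<longleftrightarrow> \<not> sat G m d e f"
| "sat G m d e (AndQ f g) \<longleftrightarrow> sat G m d e f \<and> sat G m d e g"
| "sat G m d e (ExQ f) \<longleftrightarrow> (\<exists>v\<in>verts G. sat G m (Suc d) (e(d := v)) f)"

primrec wf_query :: "nat \<Rightarrow> query \<Rightarrow> bool" where
  "wf_query d (Nb i j) \<longleftrightarrow> i < d \<and> j < d"
| "wf_query d (Same i j) \<longleftrightarrow> i < d \<and> j < d"
| "wf_query d (Less i j) \<longleftrightarrow> i < d \<and> j < d"
| "wf_query d (Lab x i) \<longleftrightarrow> i < d"
| "wf_query d (NotQ f) \<longleftrightarrow> wf_query d f"
| "wf_query d (AndQ f g) \<longleftrightarrow> wf_query d f \<and> wf_query d g"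
| "wf_query d (ExQ f) \<longleftrightarrow> wf_query (Suc d) f"

primrec labels :: "query \<Rightarrow> nat set" where
  "labels (Nb i j) = {}"
| "labels (Same i j) = {}"
| "labels (Less i j) = {}"
| "labels (Lab x i) = {x}"
| "labels (NotQ f) = labels f"
| "labels (AndQ f g) = labels f \<union> labels g"
| "labels (ExQ f) = labels f"

primrec rank :: "query \<Rightarrow> nat" where
  "rank (Nb i j) = 0"
| "rank (Same i j) = 0"
| "rank (Less i j) = 0"
| "rank (Lab x i) = 0"
| "rank (NotQ f) = rank f"
| "rank (AndQ f g) = max (rank f) (rank g)"
| "rank (ExQ f) = Suc (rank f)"

lemma sat_cong:
  assumes "wf_query d f" "\<And>i. i < d \<Longrightarrow> e i = e' i" "\<And>x. x \<in> labels f \<Longrightarrow> m x = m' x"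
  shows "sat G m d e f \<longleftrightarrow> sat G m' d e' f"
  using assms
proof (induction f arbitrary: d e e')
  case (ExQ f)
  have "sat G m (Suc d) (e(d := v)) f \<longleftrightarrow> sat G m' (Suc d) (e'(d := v)) f" for v
    using ExQ.prems by (intro ExQ.IH) auto
  then show ?case by simp
next
  case (AndQ f g)
  then show ?case by (metis UnCI labels.simps(6) sat.simps(6) wf_query.simps(6))
qed auto

text \<open>Array 2 holds the values of the variables. The truth value of a query below \<open>d\<close> quantifiers
  is left in entry \<open>d\<close> of array 3.\<close>

abbreviation "var i \<equiv> Read 2 (Lit i)"
abbreviation "res i \<equiv> Read 3 (Lit i)"

definition decide :: "nat \<Rightarrow> bexp \<Rightarrow> com" where
  "decide d b = Cond b (Write 3 (Lit d) (Lit 1)) (Write 3 (Lit d) (Lit 0))"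

definition For :: "nat \<Rightarrow> com \<Rightarrow> com" where
  "For d c = Seq (Write 2 (Lit d) (Lit 0))
     (Loop (Lt (var d) Size) (Seq c (Write 2 (Lit d) (Add (var d) (Lit 1)))))"

primrec compile :: "nat \<Rightarrow> query \<Rightarrow> com" where
  "compile d (Nb i j) =
     decide d (Conj (Neg (Eq (var i) (var j))) (Eq (Query (var i) (var j)) (Lit 0)))"
| "compile d (Same i j) = decide d (Eq (var i) (var j))"
| "compile d (Less i j) = decide d (Lt (var i) (var j))"
| "compile d (Lab x i) = decide d (Neg (Eq (Read x (var i)) (Lit 0)))"
| "compile d (NotQ f) = Seq (compile d f) (decide d (Eq (res d) (Lit 0)))"
| "compile d (AndQ f g) = Seq (compile d f) (Cond (Eq (res d) (Lit 0)) Skip (compile d g))"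
| "compile d (ExQ f) = Seq (Write 3 (Lit d) (Lit 0))
     (For d (Seq (compile (Suc d) f)
        (Cond (Eq (res (Suc d)) (Lit 0)) Skip (Write 3 (Lit d) (Lit 1)))))"

section \<open>Running times of loops and compiled queries\<close>

lemma exec_WriteI:
  assumes "aval G f s \<le> W" "t = 1 + acost e + acost f" "s' = s(x := (s x)(aval G e s := aval G f s))"
  shows "exec W G (Write x e f) s t s'"
  using Write[OF assms(1)] assms(2,3) by simp

lemma exec_CondI:
  assumes "if bval G b s then exec W G c s t s' else exec W G d s t s'" "u = bcost b + t"
  shows "exec W G (Cond b c d) s u s'"
  using assms CondTrue CondFalse by (metis (full_types))

lemma exec_decide:
  assumes "W \<ge> 1"
  shows "exec W G (decide d b) s (bcost b + 3) (s(3 := (s 3)(d := of_bool (bval G b s))))"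
  unfolding decide_def using assms by (intro exec_CondI[where t = 3]) (auto intro: exec_WriteI)

text \<open>Invariant rule for counting loops: \<open>I v\<close> holds before the round for vertex
  \<open>v\<close>, and the body must restore the counter. Each round costs 4 for the test and 6 for
  the increment besides the body; the initialisation (3) and the last test (4) are charged to the
  extra summand 1.\<close>

lemma exec_For:
  assumes W: "W \<ge> card (verts G)"
    and I0: "I 0 (s(2 := (s 2)(d := 0)))"
    and step: "\<And>v r. \<lbrakk>v < card (verts G); I v r; r 2 d = v\<rbrakk> \<Longrightarrow>
      \<exists>t\<le>C. \<exists>r'. exec W G c r t r' \<and> r' 2 d = v \<and> I (Suc v) (r'(2 := (r' 2)(d := Suc v)))"
  shows "\<exists>t\<le>(C + 10) * (card (verts G) + 1). \<exists>r. exec W G (For d c) s t r \<and>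
    I (card (verts G)) r \<and> r 2 d = card (verts G)"
proof -
  let ?n = "card (verts G)"
  let ?b = "Lt (var d) Size"
  let ?c = "Seq c (Write 2 (Lit d) (Add (var d) (Lit 1)))"
  have "\<exists>t\<le>(C + 10) * (?n - v) + 4. \<exists>r'. exec W G (Loop ?b ?c) r t r' \<and> I ?n r' \<and> r' 2 d = ?n"
    if "v \<le> ?n" "I v r" "r 2 d = v" for v r
    using that
  proof (induction "?n - v" arbitrary: v r)
    case 0
    then have "v = ?n" by simp
    with 0 have "exec W G (Loop ?b ?c) r (bcost ?b) r" by (intro LoopFalse) simp
    moreover have "bcost ?b = 4" by simp
    ultimately show ?case using 0 \<open>v = ?n\<close> by (metis le_add2)
  next
    case (Suc k)
    then have v: "v < ?n" by simp
    from step[OF v Suc.prems(2,3)] obtain t r' where r': "t \<le> C" "exec W G c r t r'" "r' 2 d = v"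
      "I (Suc v) (r'(2 := (r' 2)(d := Suc v)))" by blast
    let ?r = "r'(2 := (r' 2)(d := Suc v))"
    have "exec W G (Write 2 (Lit d) (Add (var d) (Lit 1))) r' 6 ?r"
      using r'(3) v W by (intro exec_WriteI) auto
    then have body: "exec W G ?c r (t + 6) ?r" using r'(2) by (rule Seq[rotated])
    have "k = ?n - Suc v" "Suc v \<le> ?n" using Suc.hyps(2) by auto
    from Suc.hyps(1)[OF this r'(4)] obtain t' r'' where
      r'': "t' \<le> (C + 10) * (?n - Suc v) + 4" "exec W G (Loop ?b ?c) ?r t' r''" "I ?n r''" "r'' 2 d = ?n"
      by auto
    have "bval G ?b r" using Suc.prems v by simp
    from LoopTrue[OF this body r''(2)] have "exec W G (Loop ?b ?c) r (4 + (t + 6) + t') r''"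
      by simp
    moreover have "4 + (t + 6) + t' \<le> (C + 10) * (?n - v) + 4"
    proof -
      have "?n - v = Suc (?n - Suc v)" using v by simp
      then have "(C + 10) * (?n - v) = C + 10 + (C + 10) * (?n - Suc v)" by simp
      with r'(1) r''(1) show ?thesis by linarith
    qed
    ultimately show ?case using r'' by blast
  qed
  from this[of 0 "s(2 := (s 2)(d := 0))"] I0 obtain t r where
    r: "t \<le> (C + 10) * ?n + 4" "exec W G (Loop ?b ?c) (s(2 := (s 2)(d := 0))) t r" "I ?n r" "r 2 d = ?n"
    by auto
  have "exec W G (Write 2 (Lit d) (Lit 0)) s 3 (s(2 := (s 2)(d := 0)))"
    by (rule exec_WriteI) simp_all
  from Seq[OF this r(2)] have "exec W G (For d c) s (3 + t) r" by (simp add: For_def)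
  moreover have "3 + t \<le> (C + 10) * (?n + 1)" using r(1) by simp
  ultimately show ?thesis using r by blast
qed

text \<open>Frame condition: code at depth \<open>d\<close> may disturb the two scratch arrays 2 and
  3 only at entries from \<open>d\<close> on. For d = 0 it says that all other arrays
  coincide.\<close>

definition agree :: "nat \<Rightarrow> memory \<Rightarrow> memory \<Rightarrow> bool" where
  "agree d s s' \<longleftrightarrow> (\<forall>x. x \<noteq> 2 \<and> x \<noteq> 3 \<longrightarrow> s' x = s x) \<and> (\<forall>i<d. s' 2 i = s 2 i \<and> s' 3 i = s 3 i)"

lemma agree_trans: "agree d s s' \<Longrightarrow> agree d s' s'' \<Longrightarrow> agree d s s''"
  by (simp add: agree_def)

lemma agree_sat:
  assumes "agree d s s'" "wf_query d f" "labels f \<inter> {2, 3} = {}"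
  shows "sat G s' d (s' 2) f \<longleftrightarrow> sat G s d (s 2) f"
proof (rule sat_cong)
  fix x assume "x \<in> labels f"
  then have "x \<noteq> 2" "x \<noteq> 3" using assms(3) by auto
  then show "s' x = s x" using assms(1) by (simp add: agree_def)
qed (use assms in \<open>auto simp: agree_def\<close>)

text \<open>The constants dominate the cost of the compiled code. An atom takes at most 17 steps for
  its test and 3 for the write; a quantifier adds 17 steps per round (7 to record the result, 10 for
  the loop) and 3 at the start.\<close>

primrec weight :: "query \<Rightarrow> nat" where
  "weight (Nb i j) = 20"
| "weight (Same i j) = 20"
| "weight (Less i j) = 20"
| "weight (Lab x i) = 20"
| "weight (NotQ f) = weight f + 10"
| "weight (AndQ f g) = weight f + weight g + 10"
| "weight (ExQ f) = weight f + 30"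

lemma exec_decide_atom:
  assumes "W \<ge> 1" "bcost b \<le> 17"
  shows "\<exists>t\<le>20. \<exists>s'. exec W G (decide d b) s t s' \<and> agree d s s' \<and> s' 3 d = of_bool (bval G b s)"
proof (intro exI conjI)
  show "exec W G (decide d b) s (bcost b + 3) (s(3 := (s 3)(d := of_bool (bval G b s))))"
    by (rule exec_decide[OF assms(1)])
qed (use assms(2) in \<open>auto simp: agree_def\<close>)

text \<open>Each quantifier is one loop, hence one factor n + 1. The frame condition
  \<open>agree d\<close> is part of the induction, since the second conjunct and the later rounds of
  a loop run in memory already altered by earlier evaluations. The bound on \<open>W\<close> admits
  loop counters up to \<open>n\<close> and the flags 0 and 1.\<close>

lemma exec_compile:
  assumes G: "verts G = {..<n}" and W: "W \<ge> n + 1"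
    and f: "wf_query d f" "labels f \<inter> {2, 3} = {}" and s: "\<And>i. i < d \<Longrightarrow> s 2 i < n"
  shows "\<exists>t\<le>weight f * (n + 1) ^ rank f. \<exists>s'. exec W G (compile d f) s t s' \<and> agree d s s' \<and>
    s' 3 d = of_bool (sat G s d (s 2) f)"
  using f s
proof (induction f arbitrary: d s)
  case (NotQ f)
  then have f: "wf_query d f" "labels f \<inter> {2, 3} = {}" by auto
  from NotQ.IH[of d s, OF f NotQ.prems(3)] obtain t s' where s': "t \<le> weight f * (n + 1) ^ rank f" "exec W G (compile d f) s t s'"
    "agree d s s'" "s' 3 d = of_bool (sat G s d (s 2) f)" by blast
  have one: "1 \<le> (n + 1) ^ rank f" by simp
  define r where "r = s'(3 := (s' 3)(d := of_bool (bval G (Eq (res d) (Lit 0)) s')))"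
  have "exec W G (compile d (NotQ f)) s (t + (4 + 3)) r"
    using Seq[OF s'(2) exec_decide[of W G d "Eq (res d) (Lit 0)" s']] W by (simp add: r_def)
  moreover have "t + (4 + 3) \<le> weight (NotQ f) * (n + 1) ^ rank (NotQ f)"
    using s'(1) one unfolding weight.simps rank.simps add_mult_distrib by linarith
  moreover have "agree d s r" using s'(3) by (simp add: agree_def r_def)
  moreover have "r 3 d = of_bool (sat G s d (s 2) (NotQ f))" using s'(4) by (simp add: r_def)
  ultimately show ?case by (intro exI[of _ "t + (4 + 3)"] conjI exI[of _ r])
next
  case (AndQ f g)
  then have f: "wf_query d f" "labels f \<inter> {2, 3} = {}" and g: "wf_query d g" "labels g \<inter> {2, 3} = {}"
    by auto
  from AndQ.IH(1)[of d s, OF f AndQ.prems(3)] obtain t s' where s': "t \<le> weight f * (n + 1) ^ rank f" "exec W G (compile d f) s t s'"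
    "agree d s s'" "s' 3 d = of_bool (sat G s d (s 2) f)" by blast
  let ?r = "max (rank f) (rank g)"
  have one: "1 \<le> (n + 1) ^ ?r" by simp
  have rf: "weight f * (n + 1) ^ rank f \<le> weight f * (n + 1) ^ ?r"
    by (intro mult_left_mono power_increasing) auto
  have rg: "weight g * (n + 1) ^ rank g \<le> weight g * (n + 1) ^ ?r"
    by (intro mult_left_mono power_increasing) auto
  have w: "weight (AndQ f g) * (n + 1) ^ ?r =
    weight f * (n + 1) ^ ?r + weight g * (n + 1) ^ ?r + 10 * (n + 1) ^ ?r"
    by (simp only: weight.simps add_mult_distrib)
  show ?case
  proof (cases "sat G s d (s 2) f")
    case False
    then have "exec W G (Cond (Eq (res d) (Lit 0)) Skip (compile d g)) s' (4 + 1) s'"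
      using Skip[of W G s'] s'(4) by (intro exec_CondI) auto
    from Seq[OF s'(2) this] have "exec W G (compile d (AndQ f g)) s (t + (4 + 1)) s'" by simp
    moreover have "t + (4 + 1) \<le> weight (AndQ f g) * (n + 1) ^ rank (AndQ f g)"
      unfolding rank.simps w using s'(1) rf one by linarith
    ultimately show ?thesis using s' False by (intro exI[of _ "t + (4 + 1)"] conjI exI[of _ s']) auto
  next
    case True
    have "s' 2 i < n" if "i < d" for i
      using AndQ.prems(3) s'(3) that by (simp add: agree_def)
    with AndQ.IH(2)[of d s', OF g] obtain t' s'' where s'': "t' \<le> weight g * (n + 1) ^ rank g"
      "exec W G (compile d g) s' t' s''" "agree d s' s''" "s'' 3 d = of_bool (sat G s' d (s' 2) g)"
      by blast
    have "exec W G (Cond (Eq (res d) (Lit 0)) Skip (compile d g)) s' (4 + t') s''"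
      using s''(2) s'(4) True by (intro exec_CondI) auto
    from Seq[OF s'(2) this] have "exec W G (compile d (AndQ f g)) s (t + (4 + t')) s''" by simp
    moreover have "t + (4 + t') \<le> weight (AndQ f g) * (n + 1) ^ rank (AndQ f g)"
      unfolding rank.simps w using s'(1) s''(1) rf rg one by linarith
    moreover have "sat G s' d (s' 2) g \<longleftrightarrow> sat G s d (s 2) g"
      using agree_sat[OF s'(3) g] .
    ultimately show ?thesis using s'' True agree_trans[OF s'(3) s''(3)]
      by (intro exI[of _ "t + (4 + t')"] conjI exI[of _ s'']) auto
  qed
next
  case (ExQ f)
  have card: "card (verts G) = n" using G by simp
  let ?s = "s(3 := (s 3)(d := 0))"
  let ?K = "weight f * (n + 1) ^ rank f"
  let ?c = "Seq (compile (Suc d) f) (Cond (Eq (res (Suc d)) (Lit 0)) Skip (Write 3 (Lit d) (Lit 1)))"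
  \<comment> \<open>Entry \<open>d\<close> of array 3 holds the disjunction over the values tried so
    far, always with respect to the initial memory \<open>s\<close>.\<close>
  define I where "I v r \<longleftrightarrow> agree d s r \<and>
    r 3 d = of_bool (\<exists>w<v. sat G s (Suc d) ((s 2)(d := w)) f)" for v r
  have "\<exists>t\<le>(?K + 7 + 10) * (card (verts G) + 1). \<exists>r. exec W G (For d ?c) ?s t r \<and>
    I (card (verts G)) r \<and> r 2 d = card (verts G)"
  proof (rule exec_For)
    show "I 0 (?s(2 := (?s 2)(d := 0)))" by (simp add: I_def agree_def)
  next
    fix v r assume v: "v < card (verts G)" and I: "I v r" and rv: "r 2 d = v"
    have "wf_query (Suc d) f" "labels f \<inter> {2, 3} = {}" using ExQ.prems by auto
    note f = this
    have "r 2 i < n" if "i < Suc d" for i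
      using that v rv card ExQ.prems(3) I by (auto simp: I_def agree_def less_Suc_eq)
    with ExQ.IH[of "Suc d" r, OF f] obtain t s' where s': "t \<le> ?K" "exec W G (compile (Suc d) f) r t s'"
      "agree (Suc d) r s'" "s' 3 (Suc d) = of_bool (sat G r (Suc d) (r 2) f)"
      by blast
    have sat: "sat G r (Suc d) (r 2) f \<longleftrightarrow> sat G s (Suc d) ((s 2)(d := v)) f"
    proof (rule sat_cong)
      fix y assume "y \<in> labels f"
      then have "y \<noteq> 2" "y \<noteq> 3" using ExQ.prems by auto
      then show "r y = s y" using I by (simp add: I_def agree_def)
    qed (use ExQ.prems rv I in \<open>auto simp: I_def agree_def\<close>)
    have ag: "agree d s s'" and d: "s' 2 d = v"
      using I s'(3) rv by (auto simp: I_def agree_def)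
    show "\<exists>t\<le>?K + 7. \<exists>r'. exec W G ?c r t r' \<and> r' 2 d = v \<and> I (Suc v) (r'(2 := (r' 2)(d := Suc v)))"
    proof (cases "sat G r (Suc d) (r 2) f")
      case False
      have "exec W G (Cond (Eq (res (Suc d)) (Lit 0)) Skip (Write 3 (Lit d) (Lit 1))) s' (4 + 1) s'"
        using Skip[of W G s'] s'(4) False by (intro exec_CondI) auto
      from Seq[OF s'(2) this] have "exec W G ?c r (t + (4 + 1)) s'" .
      moreover have "s' 3 d = r 3 d" using s'(3) by (simp add: agree_def)
      then have "I (Suc v) (s'(2 := (s' 2)(d := Suc v)))"
        using I ag sat False by (auto simp: I_def agree_def less_Suc_eq)
      moreover have "t + (4 + 1) \<le> ?K + 7" using s'(1) by simp
      ultimately show ?thesis using d by blast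
    next
      case True
      let ?t = "s'(3 := (s' 3)(d := 1))"
      have "exec W G (Write 3 (Lit d) (Lit 1)) s' 3 ?t"
        using W by (intro exec_WriteI) auto
      then have "exec W G (Cond (Eq (res (Suc d)) (Lit 0)) Skip (Write 3 (Lit d) (Lit 1))) s' (4 + 3) ?t"
        using s'(4) True by (intro exec_CondI) auto
      from Seq[OF s'(2) this] have "exec W G ?c r (t + (4 + 3)) ?t" .
      moreover have "I (Suc v) (?t(2 := (?t 2)(d := Suc v)))"
        using ag sat True by (auto simp: I_def agree_def less_Suc_eq)
      moreover have "t + (4 + 3) \<le> ?K + 7" using s'(1) by simp
      moreover have "?t 2 d = v" using d by simp
      ultimately show ?thesis by blast
    qed
  qed (use W card in auto)
  then obtain t r where r: "t \<le> (?K + 7 + 10) * (n + 1)" "exec W G (For d ?c) ?s t r" "I n r"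
    using card by auto
  have "exec W G (Write 3 (Lit d) (Lit 0)) s 3 ?s"
    by (rule exec_WriteI) simp_all
  from Seq[OF this r(2)] have "exec W G (compile d (ExQ f)) s (3 + t) r" by simp
  moreover have "3 + t \<le> weight (ExQ f) * (n + 1) ^ rank (ExQ f)"
  proof -
    have "1 \<le> (n + 1) ^ rank f" by simp
    then have "?K + 20 \<le> weight (ExQ f) * (n + 1) ^ rank f"
      unfolding weight.simps add_mult_distrib by linarith
    then have "(?K + 20) * (n + 1) \<le> weight (ExQ f) * (n + 1) ^ rank f * (n + 1)"
      by (rule mult_right_mono) simp
    moreover have "3 + (?K + 17) * (n + 1) \<le> (?K + 20) * (n + 1)"
      by (simp add: add_mult_distrib)
    moreover have "(?K + 7 + 10) * (n + 1) = (?K + 17) * (n + 1)" by simp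
    moreover have "weight (ExQ f) * (n + 1) ^ rank (ExQ f) = weight (ExQ f) * (n + 1) ^ rank f * (n + 1)"
      by (simp only: rank.simps power_Suc2 mult.assoc)
    ultimately show ?thesis using r(1) by linarith
  qed
  moreover have "agree d s r" "r 3 d = of_bool (sat G s d (s 2) (ExQ f))"
    using r(3) G by (auto simp: I_def Bex_def)
  ultimately show ?case by (intro exI[of _ "3 + t"] conjI exI[of _ r])
next
  case (Nb i j)
  let ?b = "Conj (Neg (Eq (var i) (var j))) (Eq (Query (var i) (var j)) (Lit 0))"
  have "s 2 i < n" "s 2 j < n" using Nb by auto
  then have "bval G ?b s \<longleftrightarrow> sat G s d (s 2) (Nb i j)"
    using G by (auto simp: adj_complement)
  then show ?case using exec_decide_atom[of W ?b G d s] W by simp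
next
  case (Same i j)
  then show ?case using exec_decide_atom[of W "Eq (var i) (var j)" G d s] W by simp
next
  case (Less i j)
  then show ?case using exec_decide_atom[of W "Lt (var i) (var j)" G d s] W by simp
next
  case (Lab x i)
  then show ?case using exec_decide_atom[of W "Neg (Eq (Read x (var i)) (Lit 0))" G d s] W by simp
qed

section \<open>Programs that label the vertices\<close>

text \<open>The statement \<open>(x, k, f)\<close> writes \<open>k\<close> into the entries of array \<open>x\<close> at all vertices that
  satisfy \<open>f\<close>.\<close>

type_synonym stmt = "nat \<times> nat \<times> query"

fun mark :: "stmt \<Rightarrow> com" where
  "mark (x, k, f) =
     For 0 (Seq (compile 1 f) (Cond (Eq (res 1) (Lit 0)) Skip (Write x (var 0) (Lit k))))"

fun effect :: "nat ugraph \<Rightarrow> stmt \<Rightarrow> memory \<Rightarrow> memory" where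
  "effect G (x, k, f) m =
     m(x := \<lambda>v. if v \<in> verts G \<and> sat G m 1 (\<lambda>_. v) f then k else m x v)"

text \<open>A statement must not read the array it writes: the vertices are then tested one after
  the other with the same outcome as in the simultaneous update \<open>effect\<close>. Arrays 2 and
  3 are reserved as scratch space.\<close>

fun admissible :: "stmt \<Rightarrow> bool" where
  "admissible (x, k, f) \<longleftrightarrow> wf_query 1 f \<and> labels f \<inter> {2, 3, x} = {} \<and> x \<noteq> 2 \<and> x \<noteq> 3"

fun stmt_weight :: "stmt \<Rightarrow> nat" where
  "stmt_weight (x, k, f) = weight f + 30"

fun stmt_rank :: "stmt \<Rightarrow> nat" where
  "stmt_rank (x, k, f) = Suc (rank f)"

fun stmt_value :: "stmt \<Rightarrow> nat" where
  "stmt_value (x, k, f) = k"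

lemma exec_mark:
  assumes G: "verts G = {..<n}" and W: "W \<ge> n + 1" "W \<ge> stmt_value p"
    and p: "admissible p" and s: "agree 0 m s"
  shows "\<exists>t\<le>stmt_weight p * (n + 1) ^ stmt_rank p. \<exists>s'. exec W G (mark p) s t s' \<and>
    agree 0 (effect G p m) s'"
proof -
  obtain x k f where pf: "p = (x, k, f)" by (cases p)
  have f: "wf_query 1 f" "labels f \<inter> {2, 3} = {}" "x \<notin> labels f" and x: "x \<noteq> 2" "x \<noteq> 3"
    using p by (auto simp: pf)
  have card: "card (verts G) = n" using G by simp
  let ?K = "weight f * (n + 1) ^ rank f"
  let ?c = "Seq (compile 1 f) (Cond (Eq (res 1) (Lit 0)) Skip (Write x (var 0) (Lit k)))"
  \<comment> \<open>After the vertices below \<open>v\<close> have been treated, exactly their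
    entries of array \<open>x\<close> are updated.\<close>
  define I where "I v r \<longleftrightarrow>
    agree 0 (m(x := \<lambda>w. if w < v \<and> sat G m 1 (\<lambda>_. w) f then k else m x w)) r" for v r
  have "\<exists>t\<le>(?K + 8 + 10) * (card (verts G) + 1). \<exists>r. exec W G (For 0 ?c) s t r \<and>
    I (card (verts G)) r \<and> r 2 0 = card (verts G)"
  proof (rule exec_For)
    show "I 0 (s(2 := (s 2)(0 := 0)))" using s x by (auto simp: I_def agree_def)
  next
    fix v r assume v: "v < card (verts G)" and I: "I v r" and rv: "r 2 0 = v"
    obtain t s' where s': "t \<le> ?K" "exec W G (compile 1 f) r t s'"
      "agree 1 r s'" "s' 3 1 = of_bool (sat G r 1 (r 2) f)"
      using exec_compile[OF G W(1) f(1,2), of r] v rv card by auto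
    have sat: "sat G r 1 (r 2) f \<longleftrightarrow> sat G m 1 (\<lambda>_. v) f"
    proof (rule sat_cong)
      fix y assume "y \<in> labels f"
      then have "y \<noteq> 2" "y \<noteq> 3" "y \<noteq> x" using f by auto
      then show "r y = m y" using I by (simp add: I_def agree_def)
    qed (use f rv in auto)
    have d: "s' 2 0 = v" and rx: "r x = (\<lambda>w. if w < v \<and> sat G m 1 (\<lambda>_. w) f then k else m x w)"
      and s'x: "s' x = r x" and other: "\<And>y. y \<notin> {2, 3, x} \<Longrightarrow> s' y = m y"
      using I s'(3) rv x by (auto simp: I_def agree_def)
    show "\<exists>t\<le>?K + 8. \<exists>r'. exec W G ?c r t r' \<and> r' 2 0 = v \<and> I (Suc v) (r'(2 := (r' 2)(0 := Suc v)))"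
    proof (cases "sat G r 1 (r 2) f")
      case False
      have "exec W G (Cond (Eq (res 1) (Lit 0)) Skip (Write x (var 0) (Lit k))) s' (4 + 1) s'"
        using Skip[of W G s'] s'(4) False by (intro exec_CondI) auto
      from Seq[OF s'(2) this] have "exec W G ?c r (t + (4 + 1)) s'" .
      moreover have "I (Suc v) (s'(2 := (s' 2)(0 := Suc v)))"
        using x other sat False s'x rx by (auto simp: I_def agree_def less_Suc_eq fun_eq_iff)
      moreover have "t + (4 + 1) \<le> ?K + 8" using s'(1) by simp
      ultimately show ?thesis using d by blast
    next
      case True
      let ?t = "s'(x := (s' x)(v := k))"
      have "exec W G (Write x (var 0) (Lit k)) s' 4 ?t"
        using W(2) pf d by (intro exec_WriteI) auto
      then have "exec W G (Cond (Eq (res 1) (Lit 0)) Skip (Write x (var 0) (Lit k))) s' (4 + 4) ?t"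
        using s'(4) True by (intro exec_CondI) auto
      from Seq[OF s'(2) this] have "exec W G ?c r (t + (4 + 4)) ?t" .
      moreover have "I (Suc v) (?t(2 := (?t 2)(0 := Suc v)))"
        using x other sat True s'x rx by (auto simp: I_def agree_def less_Suc_eq fun_eq_iff)
      moreover have "t + (4 + 4) \<le> ?K + 8" using s'(1) by simp
      moreover have "?t 2 0 = v" using d x by simp
      ultimately show ?thesis by blast
    qed
  qed (use W card in auto)
  then obtain t r where r: "t \<le> (?K + 8 + 10) * (n + 1)" "exec W G (For 0 ?c) s t r" "I n r"
    using card by auto
  have "t \<le> stmt_weight p * (n + 1) ^ stmt_rank p"
  proof -
    have "1 \<le> (n + 1) ^ rank f" by simp
    then have "?K + 18 \<le> (weight f + 30) * (n + 1) ^ rank f"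
      unfolding add_mult_distrib by linarith
    then have "(?K + 18) * (n + 1) \<le> (weight f + 30) * (n + 1) ^ rank f * (n + 1)"
      by (rule mult_right_mono) simp
    moreover have "(?K + 8 + 10) * (n + 1) = (?K + 18) * (n + 1)" by simp
    moreover have "stmt_weight p * (n + 1) ^ stmt_rank p = (weight f + 30) * (n + 1) ^ rank f * (n + 1)"
      by (simp only: pf stmt_weight.simps stmt_rank.simps power_Suc2 mult.assoc)
    ultimately show ?thesis using r(1) by linarith
  qed
  moreover have "effect G p m = m(x := \<lambda>w. if w < n \<and> sat G m 1 (\<lambda>_. w) f then k else m x w)"
    using G by (simp add: pf)
  then have "agree 0 (effect G p m) r" using r(3) by (simp add: I_def)
  ultimately show ?thesis using r(2) by (auto simp: pf)
qed

primrec program :: "stmt list \<Rightarrow> com" where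
  "program [] = Skip"
| "program (p # ps) = Seq (mark p) (program ps)"

lemma exec_program:
  assumes G: "verts G = {..<n}" and W: "W \<ge> n + 1" "\<And>p. p \<in> set ps \<Longrightarrow> W \<ge> stmt_value p"
    and ps: "\<And>p. p \<in> set ps \<Longrightarrow> admissible p \<and> stmt_rank p \<le> c" and s: "agree 0 m s"
  shows "\<exists>t\<le>(sum_list (map stmt_weight ps) + 1) * (n + 1) ^ c. \<exists>s'. exec W G (program ps) s t s' \<and>
    agree 0 (fold (effect G) ps m) s'"
  using W(2) ps s
proof (induction ps arbitrary: m s)
  case Nil
  have "1 \<le> (n + 1) ^ c" by simp
  with Nil.prems(3) Skip[of W G s] show ?case
    by (intro exI[of _ 1] conjI exI[of _ s]) simp_all
next
  case (Cons p ps)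
  obtain t s' where s': "t \<le> stmt_weight p * (n + 1) ^ stmt_rank p" "exec W G (mark p) s t s'"
    "agree 0 (effect G p m) s'"
    using exec_mark[OF G W(1), of p m s] Cons.prems by auto
  have "t \<le> stmt_weight p * (n + 1) ^ c"
    using s'(1) Cons.prems(2)[of p] by (meson le_trans list.set_intros(1) mult_le_mono2 power_increasing le_add2)
  moreover obtain t' s'' where s'': "t' \<le> (sum_list (map stmt_weight ps) + 1) * (n + 1) ^ c"
    "exec W G (program ps) s' t' s''" "agree 0 (fold (effect G) ps (effect G p m)) s''"
    using Cons.IH[OF _ _ s'(3)] Cons.prems(1,2) by auto
  ultimately have "t + t' \<le> (sum_list (map stmt_weight (p # ps)) + 1) * (n + 1) ^ c"
    by (simp add: add_mult_distrib)
  moreover have "exec W G (program (p # ps)) s (t + t') s''"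
    using Seq[OF s'(2) s''(2)] by simp
  ultimately show ?case using s''(3) by (metis fold_simps(2))
qed

text \<open>Every array is written by one statement only, and a query reads nothing that its own or
  a later statement writes.\<close>

fun stratified :: "stmt list \<Rightarrow> bool" where
  "stratified [] \<longleftrightarrow> True"
| "stratified ((x, k, f) # ps) \<longleftrightarrow>
     x \<notin> fst ` set ps \<and> labels f \<inter> insert x (fst ` set ps) = {} \<and> stratified ps"

lemma effect_other: "x \<noteq> fst p \<Longrightarrow> effect G p m x = m x"
  by (cases p) auto

lemma fold_effect_other: "x \<notin> fst ` set ps \<Longrightarrow> fold (effect G) ps m x = m x"
  by (induction ps arbitrary: m) (auto simp: effect_other)

text \<open>What \<open>f\<close> reads is final by the time its statement runs, so the truth of
  \<open>f\<close> then equals its truth in the final memory. The labels can therefore be described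
  by equivalences about a single memory.\<close>

lemma stratified_fold_effect:
  assumes "stratified ps" "(x, k, f) \<in> set ps" "wf_query 1 f"
  shows "fold (effect G) ps m x v = (if v \<in> verts G \<and> sat G (fold (effect G) ps m) 1 (\<lambda>_. v) f then k else m x v)"
  using assms
proof (induction ps arbitrary: m)
  case (Cons p ps)
  obtain y l g where p: "p = (y, l, g)" by (cases p)
  show ?case
  proof (cases "(x, k, f) = p")
    case False
    then have mem: "(x, k, f) \<in> set ps" using Cons.prems by auto
    then have "x \<in> fst ` set ps" by force
    then have "x \<noteq> y" using Cons.prems(1) p by auto
    then show ?thesis using Cons.IH[OF _ mem] Cons.prems p by simp
  next
    case True
    have "x \<notin> fst ` set ps" "labels f \<inter> insert x (fst ` set ps) = {}"
      using Cons.prems(1) True p by auto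
    have "sat G (fold (effect G) ps (effect G p m)) 1 (\<lambda>_. v) f \<longleftrightarrow> sat G m 1 (\<lambda>_. v) f"
    proof (rule sat_cong[OF \<open>wf_query 1 f\<close>])
      fix z assume "z \<in> labels f"
      then have "z \<noteq> x" "z \<notin> fst ` set ps"
        using \<open>labels f \<inter> insert x (fst ` set ps) = {}\<close> by auto
      with True p show "fold (effect G) ps (effect G p m) z = m z"
        by (auto simp: fold_effect_other)
    qed simp
    then show ?thesis
      using \<open>x \<notin> fst ` set ps\<close> True p by (auto simp: fold_effect_other)
  qed
qed simp

section \<open>Choosing the sides of a bipartition\<close>

text \<open>Only components with at least three vertices contain branching vertices. The left side consists
  of the side of the large component that contains its least branching vertex, and of the smaller
  vertex of each component with two vertices.\<close>

definition branching :: "(nat \<Rightarrow> nat \<Rightarrow> bool) \<Rightarrow> nat \<Rightarrow> bool" where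
  "branching E v \<longleftrightarrow> (\<exists>w w'. w \<noteq> w' \<and> E v w \<and> E v w')"

definition least_branching :: "(nat \<Rightarrow> nat \<Rightarrow> bool) \<Rightarrow> nat \<Rightarrow> bool" where
  "least_branching E c \<longleftrightarrow> branching E c \<and> \<not> (\<exists>w<c. branching E w)"

definition left_branching :: "(nat \<Rightarrow> nat \<Rightarrow> bool) \<Rightarrow> nat \<Rightarrow> bool" where
  "left_branching E v \<longleftrightarrow> branching E v \<and> (\<exists>c. least_branching E c \<and> (\<exists>w. E v w \<and> E c w))"

definition left :: "(nat \<Rightarrow> nat \<Rightarrow> bool) \<Rightarrow> nat \<Rightarrow> bool" where
  "left E v \<longleftrightarrow> left_branching E v \<or> \<not> branching E v \<and>
     (\<exists>w. E v w \<and> (branching E w \<and> \<not> left_branching E w \<or> \<not> branching E w \<and> v < w))"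

definition right :: "(nat \<Rightarrow> nat \<Rightarrow> bool) \<Rightarrow> nat \<Rightarrow> bool" where
  "right E v \<longleftrightarrow> \<not> left E v \<and> (\<exists>w. E v w)"

text \<open>\<open>X\<close> is one side of some bipartition, unknown to the program;
  \<open>left\<close> and \<open>right\<close> are defined from \<open>E\<close> alone. The
  assumption \<open>linked\<close> is what excluding \<open>two_P3\<close> contributes.\<close>

locale linked_bigraph =
  fixes E :: "nat \<Rightarrow> nat \<Rightarrow> bool" and X :: "nat set"
  assumes sym: "E u v \<Longrightarrow> E v u"
    and sides: "E u v \<Longrightarrow> u \<in> X \<longleftrightarrow> v \<notin> X"
    and linked: "\<lbrakk>branching E u; branching E v; u \<in> X \<longleftrightarrow> v \<in> X\<rbrakk> \<Longrightarrow> \<exists>w. E u w \<and> E v w"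
begin

lemma ex_least_branching: "branching E v \<Longrightarrow> \<exists>c. least_branching E c"
  unfolding least_branching_def by (metis LeastI not_less_Least)

lemma least_branching_unique: "\<lbrakk>least_branching E c; least_branching E c'\<rbrakk> \<Longrightarrow> c = c'"
  unfolding least_branching_def by (meson linorder_neqE_nat)

text \<open>A common neighbour with \<open>c\<close> forces the side of \<open>c\<close>, and
  conversely \<open>linked\<close> supplies one for every branching vertex on that side.\<close>

lemma left_branching_iff:
  assumes "least_branching E c" "branching E v"
  shows "left_branching E v \<longleftrightarrow> (v \<in> X \<longleftrightarrow> c \<in> X)"
proof
  assume "left_branching E v"
  then obtain w where "E v w" "E c w"
    using least_branching_unique[OF assms(1)] unfolding left_branching_def by blast
  then show "v \<in> X \<longleftrightarrow> c \<in> X" using sides by blast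
next
  assume "v \<in> X \<longleftrightarrow> c \<in> X"
  moreover have "branching E c" using assms(1) by (simp add: least_branching_def)
  ultimately show "left_branching E v"
    using linked assms unfolding left_branching_def by blast
qed

lemma neighbour_unique: "\<lbrakk>\<not> branching E v; E v w; E v w'\<rbrakk> \<Longrightarrow> w = w'"
  unfolding branching_def by blast

lemma left_branching_opposite:
  assumes "E u v" "branching E u" "branching E v"
  shows "left_branching E u \<longleftrightarrow> \<not> left_branching E v"
proof -
  obtain c where "least_branching E c" using ex_least_branching[OF assms(2)] by blast
  then show ?thesis using left_branching_iff assms sides by blast
qed

lemma left_opposite:
  assumes "E u v"
  shows "left E u \<longleftrightarrow> \<not> left E v"
proof -
  have lb: "left_branching E x \<Longrightarrow> branching E x" for x by (simp add: left_branching_def)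
  \<comment> \<open>A vertex of degree one has \<open>x\<close> as its only neighbour, so its label
    is determined by \<open>x\<close>.\<close>
  have pendant: "left E y \<longleftrightarrow> (branching E x \<and> \<not> left_branching E x \<or> \<not> branching E x \<and> y < x)"
    if "E x y" "\<not> branching E y" for x y
    using that sym[OF that(1)] neighbour_unique[OF that(2)] lb unfolding left_def by blast
  have "u \<noteq> v" using assms sides by blast
  show ?thesis
  proof (cases "branching E u"; cases "branching E v")
    assume "branching E u" "branching E v"
    then show ?thesis using left_branching_opposite[OF assms] by (simp add: left_def)
  next
    assume "branching E u" "\<not> branching E v"
    then show ?thesis using pendant[OF assms] by (simp add: left_def)
  next
    assume "\<not> branching E u" "branching E v"
    then show ?thesis using pendant[OF sym[OF assms]] by (simp add: left_def)
  next
    assume "\<not> branching E u" "\<not> branching E v"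
    then show ?thesis using pendant[OF assms] pendant[OF sym[OF assms]] \<open>u \<noteq> v\<close> by auto
  qed
qed

lemma left_has_neighbour: "left E v \<Longrightarrow> \<exists>w. E v w"
  unfolding left_def left_branching_def by blast

lemma left_iff_same_side:
  assumes "E u w" "branching E w" "least_branching E c"
  shows "left E u \<longleftrightarrow> (u \<in> X \<longleftrightarrow> c \<in> X)"
proof (cases "branching E u")
  case True
  then show ?thesis using left_branching_iff[OF assms(3)] by (simp add: left_def)
next
  case False
  then have "left E u \<longleftrightarrow> \<not> left_branching E w"
    using assms(1,2) neighbour_unique[OF False assms(1)]
    unfolding left_def left_branching_def[of E u] by blast
  then show ?thesis using left_branching_iff[OF assms(3,2)] sides[OF assms(1)] by blast
qed

text \<open>Two distinct comparable vertices share a neighbour, since \<open>left\<close> and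
  \<open>right\<close> exclude isolated vertices, and this neighbour is branching. If both sides
  failed, \<open>left_iff_same_side\<close> would place the two pairs on opposite sides of the
  bipartition, so one of them would lie in \<open>X\<close>.\<close>

lemma left_or_right_antichain:
  assumes X: "\<And>u v. \<lbrakk>u \<in> X; v \<in> X; \<forall>w. E u w \<longrightarrow> E v w\<rbrakk> \<Longrightarrow> u = v"
  shows "(\<forall>u v. left E u \<and> left E v \<and> (\<forall>w. E u w \<longrightarrow> E v w) \<longrightarrow> u = v) \<or>
    (\<forall>u v. right E u \<and> right E v \<and> (\<forall>w. E u w \<longrightarrow> E v w) \<longrightarrow> u = v)"
proof (rule ccontr)
  assume "\<not> ?thesis"
  then obtain u v u' v' where l: "left E u" "left E v" "\<forall>w. E u w \<longrightarrow> E v w" "u \<noteq> v"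
    and r: "right E u'" "right E v'" "\<forall>w. E u' w \<longrightarrow> E v' w" "u' \<noteq> v'" by blast
  obtain w where w: "E u w" "E v w" using left_has_neighbour l(1,3) by blast
  obtain w' where w': "E u' w'" "E v' w'" using r(1,3) unfolding right_def by blast
  have D: "branching E w" "branching E w'"
    using w w' l(4) r(4) sym unfolding branching_def by blast+
  then obtain c where c: "least_branching E c" using ex_least_branching by blast
  have "u \<in> X \<longleftrightarrow> c \<in> X" "v \<in> X \<longleftrightarrow> c \<in> X" "u' \<in> X \<longleftrightarrow> c \<notin> X" "v' \<in> X \<longleftrightarrow> c \<notin> X"
    using left_iff_same_side[OF _ _ c] D w w' l r unfolding right_def by blast+
  then show False using X[of u v] X[of u' v'] l r by blast
qed

end

text \<open>Branching vertices on the same side without a common neighbour would be the centres of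
  two disjoint stars; \<open>two_stars_not_free\<close> is used for either order of the
  sides.\<close>

lemma linked_bigraph_complement:
  assumes "simple_graph G" "labeled_bigraph (complement G) A B" "free_of G (complement two_P3)"
  shows "linked_bigraph (adj (complement G)) B"
proof
  let ?E = "adj (complement G)"
  have swap: "labeled_bigraph (complement G) B A"
    using assms(2) by (auto simp: labeled_bigraph_def)
  show sym: "?E v u" if "?E u v" for u v using that by (simp add: adj_commute)
  show "u \<in> B \<longleftrightarrow> v \<notin> B" if "?E u v" for u v
  proof -
    have "u \<in> A \<union> B" "v \<in> A \<union> B"
      using that assms(2) by (auto simp: labeled_bigraph_def adj_complement)
    moreover have "\<not> (u \<in> A \<and> v \<in> A)" "\<not> (u \<in> B \<and> v \<in> B)" "A \<inter> B = {}"
      using that assms(2) by (auto simp: labeled_bigraph_def independent_def)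
    ultimately show ?thesis by blast
  qed
  show "\<exists>w. ?E u w \<and> ?E v w"
    if "branching ?E u" "branching ?E v" and side: "u \<in> B \<longleftrightarrow> v \<in> B" for u v
  proof (rule ccontr)
    assume none: "\<not> ?thesis"
    obtain x x' y y' where xy: "x \<noteq> x'" "?E u x" "?E u x'" "y \<noteq> y'" "?E v y" "?E v y'"
      using \<open>branching ?E u\<close> \<open>branching ?E v\<close> unfolding branching_def by blast
    then have n: "\<not> ?E v x" "\<not> ?E v x'" "\<not> ?E u y" "\<not> ?E u y'" using none by auto
    have "u \<in> verts G" "v \<in> verts G" using xy by (auto simp: adj_complement)
    then have "u \<in> B \<and> v \<in> B \<or> u \<in> A \<and> v \<in> A"
      using side assms(2) by (auto simp: labeled_bigraph_def)
    then show False
      using two_stars_not_free[OF assms(1,2) _ _ xy(2,3) n(1,2) xy(1) xy(5,6) n(3,4) xy(4)]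
        two_stars_not_free[OF assms(1) swap _ _ xy(2,3) n(1,2) xy(1) xy(5,6) n(3,4) xy(4)] assms(3)
      by blast
  qed
qed

section \<open>The program\<close>

abbreviation OrQ :: "query \<Rightarrow> query \<Rightarrow> query" where
  "OrQ f g \<equiv> NotQ (AndQ (NotQ f) (NotQ g))"

definition dominated :: "nat \<Rightarrow> query" where
  "dominated x = AndQ (Lab x 0) (ExQ (AndQ (Lab x 1) (AndQ (NotQ (Same 0 1))
     (NotQ (ExQ (AndQ (Nb 0 2) (NotQ (Nb 1 2))))))))"

text \<open>Array 4 marks the branching vertices, 5 the least of them, 6 the left branching ones, 7 and 8
  the left and the right side, 9 the obstructions to the left side being an antichain. Array 10 is
  the side \<open>B\<close>, 11 the obstructions to its being an antichain, 12 the splitting vertices and 13 the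
  least of them.\<close>

definition label_queries :: "query list" where
  "label_queries =
    [ExQ (ExQ (AndQ (NotQ (Same 1 2)) (AndQ (Nb 0 1) (Nb 0 2)))),
     AndQ (Lab 4 0) (NotQ (ExQ (AndQ (Less 1 0) (Lab 4 1)))),
     AndQ (Lab 4 0) (ExQ (AndQ (Lab 5 1) (ExQ (AndQ (Nb 0 2) (Nb 1 2))))),
     OrQ (Lab 6 0) (AndQ (NotQ (Lab 4 0)) (ExQ (AndQ (Nb 0 1)
        (OrQ (AndQ (Lab 4 1) (NotQ (Lab 6 1))) (AndQ (NotQ (Lab 4 1)) (Less 0 1)))))),
     AndQ (NotQ (Lab 7 0)) (ExQ (Nb 0 1)),
     dominated 7,
     OrQ (AndQ (Lab 7 0) (NotQ (ExQ (Lab 9 1)))) (AndQ (Lab 8 0) (ExQ (Lab 9 1))),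
     dominated 10,
     AndQ (NotQ (Lab 10 0)) (NotQ (ExQ (AndQ (NotQ (Lab 10 1)) (AndQ (NotQ (Same 1 0))
        (AndQ (ExQ (AndQ (Lab 10 2) (AndQ (Nb 1 2) (Nb 0 2))))
          (ExQ (AndQ (Lab 10 2) (AndQ (NotQ (Nb 1 2)) (NotQ (Nb 0 2)))))))))),
     AndQ (Lab 12 0) (NotQ (ExQ (AndQ (Less 1 0) (Lab 12 1))))]"

text \<open>Numbering starts at 4 because arrays 0 and 1 carry the output and 2 and 3 are scratch
  space.\<close>

definition label_stmts :: "stmt list" where
  "label_stmts = map (\<lambda>(x, f). (x, 1, f)) (enumerate 4 label_queries)"

definition meets :: query where
  "meets = ExQ (AndQ (Lab 13 1) (ExQ (AndQ (Lab 10 2) (AndQ (Nb 0 2) (Nb 1 2)))))"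

text \<open>Index 0 is never written: array 1 is initially zero and the splitting vertex satisfies
  none of the four queries for it. The success flag is written at all vertices at once, in
  particular at entry 0.\<close>

definition output_stmts :: "stmt list" where
  "output_stmts =
    [(1, 1, AndQ (NotQ (OrQ (Lab 10 0) (Lab 13 0))) (NotQ meets)),
     (1, 2, AndQ (NotQ (OrQ (Lab 10 0) (Lab 13 0))) meets),
     (1, 3, AndQ (Lab 10 0) (NotQ (ExQ (AndQ (Lab 13 1) (Nb 1 0))))),
     (1, 4, AndQ (Lab 10 0) (ExQ (AndQ (Lab 13 1) (Nb 1 0)))),
     (0, 1, NotQ (ExQ (Lab 11 1)))]"

text \<open>Rank 3 is the source of the cubic running time, and the bound 4 on the values is why
  cells holding n + 4 suffice.\<close>

lemma stmts_admissible:
  "p \<in> set (label_stmts @ output_stmts) \<Longrightarrow> admissible p \<and> stmt_rank p \<le> 3"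
  "p \<in> set (label_stmts @ output_stmts) \<Longrightarrow> stmt_value p \<le> 4"
  unfolding label_stmts_def label_queries_def output_stmts_def meets_def dominated_def by auto

lemma stratified_label_stmts: "stratified label_stmts"
  by (simp add: label_stmts_def label_queries_def dominated_def)

text \<open>The output statements write array 1 repeatedly and so are not stratified. They read only
  arrays outside the set \<open>T\<close> of arrays written, so every query can be evaluated in the
  memory \<open>m\<close> before them.\<close>

lemma fold_effect_independent:
  assumes "\<And>p. p \<in> set ps \<Longrightarrow> fst p \<in> T \<and> wf_query 1 (snd (snd p)) \<and> labels (snd (snd p)) \<inter> T = {}"
    and "\<And>x. x \<notin> T \<Longrightarrow> m' x = m x"
  shows "fold (effect G) ps m' x v =
    fold (\<lambda>(y, k, f) a. if x = y \<and> v \<in> verts G \<and> sat G m 1 (\<lambda>_. v) f then k else a) ps (m' x v)"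
  using assms
proof (induction ps arbitrary: m')
  case (Cons p ps)
  obtain y k f where p: "p = (y, k, f)" by (cases p)
  have f: "y \<in> T" "wf_query 1 f" "labels f \<inter> T = {}" using Cons.prems(1)[of p] p by auto
  have "sat G m' 1 (\<lambda>_. u) f \<longleftrightarrow> sat G m 1 (\<lambda>_. u) f" for u
    using f Cons.prems(2) by (intro sat_cong) auto
  then have "effect G p m' x v = (if x = y \<and> v \<in> verts G \<and> sat G m 1 (\<lambda>_. v) f then k else m' x v)"
    by (simp add: p)
  moreover have "fold (effect G) ps (effect G p m') x v = fold (\<lambda>(y, k, f) a.
    if x = y \<and> v \<in> verts G \<and> sat G m 1 (\<lambda>_. v) f then k else a) ps (effect G p m' x v)"
  proof (rule Cons.IH)
    show "effect G p m' z = m z" if "z \<notin> T" for z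
      using that f(1) Cons.prems(2) p by (auto simp: effect_other)
  qed (use Cons.prems(1) in auto)
  ultimately show ?case by (simp add: p)
qed simp

section \<open>Meaning of the label arrays\<close>

definition labels_of :: "nat ugraph \<Rightarrow> memory" where
  "labels_of G = fold (effect G) label_stmts (\<lambda>_ _. 0)"

lemma label_iff:
  assumes "i < length label_queries"
  shows "labels_of G (4 + i) v \<noteq> 0 \<longleftrightarrow>
    v \<in> verts G \<and> sat G (labels_of G) 1 (\<lambda>_. v) (label_queries ! i)"
proof -
  have "(4 + i, label_queries ! i) \<in> set (enumerate 4 label_queries)"
    using assms by (simp add: in_set_enumerate_eq)
  then have mem: "(4 + i, 1, label_queries ! i) \<in> set label_stmts"
    by (force simp: label_stmts_def)
  then have "wf_query 1 (label_queries ! i)"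
    using stmts_admissible(1)[of "(4 + i, 1, label_queries ! i)"] by simp
  from stratified_fold_effect[OF stratified_label_stmts mem this] show ?thesis
    by (simp add: labels_of_def)
qed

locale labelled =
  fixes G :: "nat ugraph" and m :: memory and E :: "nat \<Rightarrow> nat \<Rightarrow> bool"
  defines "m \<equiv> labels_of G" and "E \<equiv> adj (complement G)"
begin

lemma label_iff':
  "i < 10 \<Longrightarrow> 0 < m (4 + i) v \<longleftrightarrow> v \<in> verts G \<and> sat G m 1 (\<lambda>_. v) (label_queries ! i)"
  using label_iff[of i G v] unfolding m_def by (simp add: label_queries_def)

lemma E_verts: "E u v \<Longrightarrow> u \<in> verts G \<and> v \<in> verts G"
  by (simp add: E_def adj_complement)

lemma label_4: "0 < m 4 v \<longleftrightarrow> branching E v"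
proof -
  have "0 < m 4 v \<longleftrightarrow> v \<in> verts G \<and> (\<exists>w\<in>verts G. \<exists>w'\<in>verts G. w \<noteq> w' \<and> E v w \<and> E v w')"
    using label_iff'[of 0 v] by (simp add: label_queries_def E_def)
  then show ?thesis unfolding branching_def using E_verts by blast
qed

lemma branching_verts: "branching E v \<Longrightarrow> v \<in> verts G"
  unfolding branching_def using E_verts by blast

lemma label_5: "0 < m 5 v \<longleftrightarrow> least_branching E v"
proof -
  have "0 < m 5 v \<longleftrightarrow> v \<in> verts G \<and> branching E v \<and> \<not> (\<exists>w\<in>verts G. w < v \<and> branching E w)"
    using label_iff'[of 1 v] by (simp add: label_queries_def label_4)
  then show ?thesis unfolding least_branching_def using branching_verts by blast
qed

lemma label_6: "0 < m 6 v \<longleftrightarrow> left_branching E v"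
proof -
  have "0 < m 6 v \<longleftrightarrow> v \<in> verts G \<and> branching E v \<and>
    (\<exists>c\<in>verts G. least_branching E c \<and> (\<exists>w\<in>verts G. E v w \<and> E c w))"
    using label_iff'[of 2 v] by (simp add: label_queries_def label_4 label_5 E_def)
  then show ?thesis unfolding left_branching_def using branching_verts E_verts by blast
qed

lemma label_7: "0 < m 7 v \<longleftrightarrow> left E v"
proof -
  have "0 < m 7 v \<longleftrightarrow> v \<in> verts G \<and> (left_branching E v \<or> \<not> branching E v \<and>
    (\<exists>w\<in>verts G. E v w \<and> (branching E w \<and> \<not> left_branching E w \<or> \<not> branching E w \<and> v < w)))"
    using label_iff'[of 3 v] by (simp add: label_queries_def label_4 label_6 E_def)
  then show ?thesis unfolding left_def left_branching_def using branching_verts E_verts by blast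
qed

lemma left_verts: "left E v \<Longrightarrow> v \<in> verts G"
  unfolding left_def left_branching_def using branching_verts E_verts by blast

lemma label_8: "0 < m 8 v \<longleftrightarrow> right E v"
proof -
  have "0 < m 8 v \<longleftrightarrow> v \<in> verts G \<and> \<not> left E v \<and> (\<exists>w\<in>verts G. E v w)"
    using label_iff'[of 4 v] by (simp add: label_queries_def label_7 E_def)
  then show ?thesis unfolding right_def using E_verts by blast
qed

lemma right_verts: "right E v \<Longrightarrow> v \<in> verts G"
  unfolding right_def using E_verts by blast

definition bad :: "(nat \<Rightarrow> bool) \<Rightarrow> nat \<Rightarrow> bool" where
  "bad P v \<longleftrightarrow> P v \<and> (\<exists>u. P u \<and> v \<noteq> u \<and> (\<forall>w. E v w \<longrightarrow> E u w))"

lemma label_9: "0 < m 9 v \<longleftrightarrow> bad (left E) v"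
proof -
  have "0 < m 9 v \<longleftrightarrow> v \<in> verts G \<and> left E v \<and>
    (\<exists>u\<in>verts G. left E u \<and> v \<noteq> u \<and> (\<forall>w\<in>verts G. E v w \<longrightarrow> E u w))"
    using label_iff'[of 5 v] by (simp add: label_queries_def dominated_def label_7 E_def)
  then show ?thesis unfolding bad_def using left_verts E_verts by blast
qed

text \<open>The right side is chosen exactly when the left side fails to be an antichain. Isolated
  vertices are neither left nor right and thus always fall into \<open>A\<close>.\<close>

definition B :: "nat set" where
  "B = {v. if \<exists>q. bad (left E) q then right E v else left E v}"

lemma B_verts: "v \<in> B \<Longrightarrow> v \<in> verts G"
  unfolding B_def by (auto simp: left_verts right_verts split: if_splits)

lemma label_10: "0 < m 10 v \<longleftrightarrow> v \<in> B"
proof -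
  have "0 < m 10 v \<longleftrightarrow> v \<in> verts G \<and> (left E v \<and> \<not> (\<exists>q\<in>verts G. bad (left E) q) \<or>
    right E v \<and> (\<exists>q\<in>verts G. bad (left E) q))"
    using label_iff'[of 6 v] by (simp add: label_queries_def label_7 label_8 label_9)
  moreover have "(\<exists>q\<in>verts G. bad (left E) q) \<longleftrightarrow> (\<exists>q. bad (left E) q)"
    using left_verts by (auto simp: bad_def)
  ultimately show ?thesis using left_verts right_verts by (auto simp: B_def)
qed

lemma label_11: "0 < m 11 v \<longleftrightarrow> bad (\<lambda>v. v \<in> B) v"
proof -
  have "0 < m 11 v \<longleftrightarrow> v \<in> verts G \<and> v \<in> B \<and>
    (\<exists>u\<in>verts G. u \<in> B \<and> v \<noteq> u \<and> (\<forall>w\<in>verts G. E v w \<longrightarrow> E u w))"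
    using label_iff'[of 7 v] by (simp add: label_queries_def dominated_def label_10 E_def)
  then show ?thesis unfolding bad_def using B_verts E_verts by blast
qed

definition A :: "nat set" where
  "A = verts G - B"

lemma label_12: "0 < m 12 v \<longleftrightarrow> v \<in> A \<and> splits (complement G) A B v"
proof -
  have "0 < m 12 v \<longleftrightarrow> v \<in> verts G \<and> v \<notin> B \<and> \<not> (\<exists>a\<in>verts G. a \<notin> B \<and> a \<noteq> v \<and>
    (\<exists>b\<in>verts G. b \<in> B \<and> E a b \<and> E v b) \<and> (\<exists>b\<in>verts G. b \<in> B \<and> \<not> E a b \<and> \<not> E v b))"
    using label_iff'[of 8 v] by (simp add: label_queries_def label_10 E_def)
  then show ?thesis unfolding A_def splits_def E_def using B_verts by blast
qed

definition Z :: "nat \<Rightarrow> bool" where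
  "Z v \<longleftrightarrow> v \<in> A \<and> splits (complement G) A B v \<and> \<not> (\<exists>u<v. u \<in> A \<and> splits (complement G) A B u)"

lemma label_13: "0 < m 13 v \<longleftrightarrow> Z v"
proof -
  have "0 < m 13 v \<longleftrightarrow> v \<in> verts G \<and> v \<in> A \<and> splits (complement G) A B v \<and>
    \<not> (\<exists>u\<in>verts G. u < v \<and> u \<in> A \<and> splits (complement G) A B u)"
    using label_iff'[of 9 v] by (simp add: label_queries_def label_12)
  then show ?thesis unfolding Z_def A_def by blast
qed

definition final :: memory where
  "final = fold (effect G) output_stmts m"

lemma m_other: "x < 4 \<Longrightarrow> m x v = 0"
  unfolding m_def labels_of_def
  by (subst fold_effect_other) (auto simp: label_stmts_def label_queries_def)

lemma final_eq:
  "final x v = fold (\<lambda>(y, k, f) a. if x = y \<and> v \<in> verts G \<and> sat G m 1 (\<lambda>_. v) f then k else a)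
    output_stmts (m x v)"
  unfolding final_def
  by (rule fold_effect_independent[where T = "{0, 1}"]) (auto simp: output_stmts_def meets_def)

lemma final_0:
  assumes "v \<in> verts G"
  shows "final 0 v = (if \<exists>q. bad (\<lambda>v. v \<in> B) q then 0 else 1)"
proof -
  have "final 0 v = (if \<exists>q\<in>verts G. 0 < m 11 q then 0 else 1)"
    using assms m_other[of 0 v] by (simp add: final_eq output_stmts_def)
  moreover have "(\<exists>q\<in>verts G. 0 < m 11 q) \<longleftrightarrow> (\<exists>q. bad (\<lambda>v. v \<in> B) q)"
    using B_verts by (auto simp: label_11 bad_def)
  ultimately show ?thesis by simp
qed

lemma final_1:
  assumes "v \<in> verts G" and z: "Z z" "\<And>z'. Z z' \<Longrightarrow> z' = z"
  shows "final 1 v = (if v \<in> B then (if E z v then 4 else 3) else if v = z then 0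
    else if \<exists>b\<in>B. E v b \<and> E z b then 2 else 1)"
proof -
  have Z: "0 < m 13 u \<longleftrightarrow> u = z" for u using z label_13[of u] by blast
  have "z \<in> verts G" "z \<notin> B" using z(1) by (simp_all add: Z_def A_def)
  have meets: "sat G m 1 (\<lambda>_. v) meets \<longleftrightarrow> (\<exists>b\<in>B. E v b \<and> E z b)"
  proof -
    have "sat G m 1 (\<lambda>_. v) meets \<longleftrightarrow> z \<in> verts G \<and> (\<exists>b\<in>verts G. b \<in> B \<and> E v b \<and> E z b)"
      by (simp add: meets_def label_10 Z E_def)
    then show ?thesis using B_verts \<open>z \<in> verts G\<close> by blast
  qed
  have nb: "sat G m 1 (\<lambda>_. v) (ExQ (AndQ (Lab 13 1) (Nb 1 0))) \<longleftrightarrow> E z v"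
    using \<open>z \<in> verts G\<close> by (simp add: Z E_def)
  have lab: "sat G m 1 (\<lambda>_. v) (Lab 10 0) \<longleftrightarrow> v \<in> B" "sat G m 1 (\<lambda>_. v) (Lab 13 0) \<longleftrightarrow> v = z"
    by (simp_all add: label_10 Z)
  have "m 1 v = 0" by (rule m_other) simp
  then show ?thesis
    unfolding final_eq output_stmts_def
    using assms(1) \<open>z \<notin> B\<close> meets nb lab
    by (simp del: sat.simps(4,7)) blast
qed

lemma nbhd_subset_iff: "nbhd (complement G) u \<subseteq> nbhd (complement G) v \<longleftrightarrow> (\<forall>w. E u w \<longrightarrow> E v w)"
  using E_verts by (auto simp: nbhd_def E_def adj_commute)

section \<open>Correctness of the computed bipartition and decomposition\<close>

context
  assumes simple: "simple_graph G" and cobip: "cobipartite G"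
    and free: "free_of G (complement two_P3)"
begin

lemma linked_bigraph_if:
  assumes "labeled_bigraph (complement G) A' B'"
  shows "linked_bigraph E B'"
  unfolding E_def by (rule linked_bigraph_complement[OF simple assms free])

lemma E_opposite:
  assumes "E u v"
  shows "u \<in> B \<longleftrightarrow> v \<notin> B"
proof -
  obtain A0 B0 where "labeled_bigraph (complement G) A0 B0"
    using cobip by (auto simp: cobipartite_def bipartite_def)
  then interpret linked_bigraph E B0 by (rule linked_bigraph_if)
  \<comment> \<open>For vertices with a neighbour, \<open>right\<close> is the negation of
    \<open>left\<close>, so both choices of \<open>B\<close> separate the ends of an edge.\<close>
  have "\<exists>w. E u w" "\<exists>w. E v w" using assms sym by blast+
  then show ?thesis
    using left_opposite[OF assms] unfolding B_def right_def by simp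
qed

lemma labeled_bigraph_A_B: "labeled_bigraph (complement G) A B"
  unfolding labeled_bigraph_def independent_def A_def
proof (intro conjI ballI)
  show "\<not> adj (complement G) u v" if "u \<in> verts G - B" "v \<in> verts G - B" for u v
    using E_opposite[of u v] that unfolding E_def by blast
  show "\<not> adj (complement G) u v" if "u \<in> B" "v \<in> B" for u v
    using E_opposite[of u v] that unfolding E_def by blast
qed (use B_verts in auto)

lemma labeled_right_Sperner_A_B:
  assumes "\<not> (\<exists>q. bad (\<lambda>v. v \<in> B) q)"
  shows "labeled_right_Sperner (complement G) A B"
  using assms labeled_bigraph_A_B nbhd_subset_iff unfolding labeled_right_Sperner_def bad_def by blast

text \<open>A right-Sperner bipartition, taken as \<open>X\<close>, makes the left or the right side
  an antichain, and \<open>B\<close> selects the right side whenever the left one fails. So an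
  obstruction in \<open>B\<close> rules out every bipartition.\<close>

lemma not_right_Sperner:
  assumes "bad (\<lambda>v. v \<in> B) q"
  shows "\<not> right_Sperner (complement G)"
proof
  assume "right_Sperner (complement G)"
  then obtain A' B' where bi: "labeled_bigraph (complement G) A' B'"
    and anti: "\<And>u v. \<lbrakk>u \<in> B'; v \<in> B'; \<forall>w. E u w \<longrightarrow> E v w\<rbrakk> \<Longrightarrow> u = v"
    unfolding right_Sperner_def labeled_right_Sperner_def nbhd_subset_iff by blast
  interpret linked_bigraph E B' using bi by (rule linked_bigraph_if)
  have "\<not> (\<exists>q. bad (left E) q) \<or> \<not> (\<exists>q. bad (right E) q)"
    using left_or_right_antichain[OF anti] unfolding bad_def by blast
  moreover have "(\<lambda>v. v \<in> B) = (if \<exists>q. bad (left E) q then right E else left E)"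
    by (auto simp: B_def)
  ultimately show False using assms by (auto split: if_splits)
qed

text \<open>Every vertex of \<open>B\<close> has a neighbour, which lies in \<open>A\<close>. This
  also covers graphs with a single vertex.\<close>

lemma A_nonempty:
  assumes "verts G \<noteq> {}"
  shows "A \<noteq> {}"
proof (cases "verts G \<subseteq> B")
  case True
  then obtain u where "u \<in> B" using assms by blast
  then obtain w where "E u w"
    unfolding B_def right_def left_def left_branching_def branching_def by (auto split: if_splits)
  then show ?thesis using E_opposite[of u w] E_verts \<open>u \<in> B\<close> unfolding A_def by blast
qed (auto simp: A_def)

lemma correct_final:
  assumes V: "0 \<in> verts G" and s: "s 0 = final 0" "s 1 = final 1"
  shows "correct_output G s"
proof (cases "\<exists>q. bad (\<lambda>v. v \<in> B) q")
  case True
  then show ?thesis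
    using not_right_Sperner final_0[OF V] s unfolding correct_output_def by auto
next
  case False
  note S = labeled_right_Sperner_A_B[OF False]
  obtain y where "y \<in> A \<and> splits (complement G) A B y"
    using exists_splits[OF simple free S A_nonempty] V by blast
  then obtain z where z: "Z z"
    using exists_least_iff[of "\<lambda>z. z \<in> A \<and> splits (complement G) A B z"] unfolding Z_def by blast
  have uniq: "z' = z" if "Z z'" for z'
    using z that unfolding Z_def by (metis linorder_neqE_nat)
  have zA: "z \<in> A" "splits (complement G) A B z" using z by (simp_all add: Z_def)
  have AB: "A \<union> B = verts G" "A \<inter> B = {}" using B_verts by (auto simp: A_def)
  let ?A1 = "{a \<in> A - {z}. \<forall>b\<in>B. \<not> (E a b \<and> E z b)}"
  let ?A2 = "A - {z} - ?A1"
  let ?B1 = "{b \<in> B. \<not> E z b}"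
  let ?B2 = "{b \<in> B. E z b}"
  have s1: "s 1 v = (if v \<in> B then (if E z v then 4 else 3) else if v = z then 0
    else if \<exists>b\<in>B. E v b \<and> E z b then 2 else 1)" if "v \<in> verts G" for v
    using final_1[OF that z uniq] s(2) by simp
  have dec: "Sperner_decomposition G A B z ?A1 ?A2 ?B1 ?B2"
    using Sperner_decompositionI[OF free S zA refl refl refl refl] unfolding E_def .
  \<comment> \<open>The indices written by the program are compared with the parts of
    \<open>Sperner_decompositionI\<close>, separately for \<open>B\<close>, for \<open>z\<close> and
    for the rest of \<open>A\<close>.\<close>
  have mem: "(v \<in> {z} \<longleftrightarrow> v \<in> output_part G s 0) \<and> (v \<in> ?A1 \<longleftrightarrow> v \<in> output_part G s 1) \<and>
    (v \<in> ?A2 \<longleftrightarrow> v \<in> output_part G s 2) \<and> (v \<in> ?B1 \<longleftrightarrow> v \<in> output_part G s 3) \<and>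
    (v \<in> ?B2 \<longleftrightarrow> v \<in> output_part G s 4)" for v
  proof -
    have zV: "z \<in> verts G" "z \<notin> B" using zA(1) by (simp_all add: A_def)
    consider "v \<notin> verts G" | "v \<in> B" | "v = z" | "v \<in> verts G" "v \<notin> B" "v \<noteq> z" by blast
    then show ?thesis
    proof cases
      case 1
      then have "v \<notin> A" "v \<notin> B" "v \<noteq> z" using AB zV by auto
      with 1 show ?thesis by (simp add: output_part_def)
    next
      case 2
      then have "v \<notin> A" "v \<in> verts G" "v \<noteq> z" using AB zV by auto
      with 2 show ?thesis by (simp add: output_part_def s1 del: One_nat_def)
    next
      case 3
      with zV zA(1) show ?thesis by (simp add: output_part_def s1 del: One_nat_def)
    next
      case 4
      then have "v \<in> A" by (simp add: A_def)
      show ?thesis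
        by (cases "\<exists>b\<in>B. E v b \<and> E z b") (use 4 \<open>v \<in> A\<close> in \<open>simp_all add: output_part_def s1 del: One_nat_def\<close>)
    qed
  qed
  have "{z} = output_part G s 0" "?A1 = output_part G s 1" "?A2 = output_part G s 2"
    "?B1 = output_part G s 3" "?B2 = output_part G s 4"
    by (rule set_eqI[OF mem[THEN conjunct1]], rule set_eqI[OF mem[THEN conjunct2, THEN conjunct1]],
        rule set_eqI[OF mem[THEN conjunct2, THEN conjunct2, THEN conjunct1]],
        rule set_eqI[OF mem[THEN conjunct2, THEN conjunct2, THEN conjunct2, THEN conjunct1]],
        rule set_eqI[OF mem[THEN conjunct2, THEN conjunct2, THEN conjunct2, THEN conjunct2]])
  moreover have "A = {z} \<union> ?A1 \<union> ?A2" "B = ?B1 \<union> ?B2" using zA by auto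
  moreover have "s 0 0 = 1" using final_0[OF V] s(1) False by simp
  ultimately show ?thesis
    unfolding correct_output_def using S dec by (intro disjI1 conjI exI)
qed

end

end

section \<open>Assembly of correctness and running time\<close>

lemma program_correct:
  assumes n: "n \<ge> 1" and G: "verts G = {..<n}" "simple_graph G" "cobipartite G"
    "free_of G (complement two_P3)"
  defines "ps \<equiv> label_stmts @ output_stmts"
  shows "\<exists>t s. exec (n + 4) G (program ps) (\<lambda>_ _. 0) t s \<and>
    t \<le> (sum_list (map stmt_weight ps) + 1) * (n + 1) ^ 3 \<and> correct_output G s"
proof -
  have "\<exists>t\<le>(sum_list (map stmt_weight ps) + 1) * (n + 1) ^ 3. \<exists>s. exec (n + 4) G (program ps) (\<lambda>_ _. 0) t s \<and>
    agree 0 (fold (effect G) ps (\<lambda>_ _. 0)) s"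
    unfolding ps_def using stmts_admissible by (intro exec_program[OF G(1)]) (force simp: agree_def)+
  then obtain t s where t: "t \<le> (sum_list (map stmt_weight ps) + 1) * (n + 1) ^ 3"
    "exec (n + 4) G (program ps) (\<lambda>_ _. 0) t s" "agree 0 (fold (effect G) ps (\<lambda>_ _. 0)) s"
    by blast
  have "fold (effect G) ps (\<lambda>_ _. 0) = labelled.final G"
    by (simp add: ps_def labelled.final_def labels_of_def)
  with t(3) have "s 0 = labelled.final G 0" "s 1 = labelled.final G 1"
    by (simp_all add: agree_def)
  then have "correct_output G s"
    using n G by (intro labelled.correct_final) auto
  with t show ?thesis by blast
qed

theorem theorem5p6:
  shows "(\<forall>(G :: 'a ugraph) A B.
      simple_graph G \<and> card (verts G) \<ge> 2 \<and> cobipartite G \<and>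
      free_of G (complement two_P3) \<and> right_Sperner (complement G) \<and>
      labeled_right_Sperner (complement G) A B \<longrightarrow>
      (\<exists>z A1 A2 B1 B2. Sperner_decomposition G A B z A1 A2 B1 B2))
    \<and>
    (\<exists>(P :: com) (T :: nat \<Rightarrow> nat) (W :: nat \<Rightarrow> nat) (d :: nat).
      (\<lambda>n. real (T n)) \<in> O(\<lambda>n. real n ^ 3) \<and>
      (\<lambda>n. real (W n)) \<in> O(\<lambda>n. real n ^ d) \<and>
      (\<forall>(n :: nat) (G :: nat ugraph).
        n \<ge> 1 \<and> simple_graph G \<and> verts G = {..<n} \<and> cobipartite G \<and>
        free_of G (complement two_P3) \<longrightarrow>
        (\<exists>t s. exec (W n) G P (\<lambda>_ _. 0) t s \<and> t \<le> T n \<and> correct_output G s)))"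
proof (intro conjI)
  show "\<forall>(G :: 'a ugraph) A B.
      simple_graph G \<and> card (verts G) \<ge> 2 \<and> cobipartite G \<and>
      free_of G (complement two_P3) \<and> right_Sperner (complement G) \<and>
      labeled_right_Sperner (complement G) A B \<longrightarrow>
      (\<exists>z A1 A2 B1 B2. Sperner_decomposition G A B z A1 A2 B1 B2)"
    using exists_Sperner_decomposition by blast
next
  let ?ps = "label_stmts @ output_stmts"
  define K where "K = sum_list (map stmt_weight ?ps) + 1"
  have "(\<lambda>n. real (K * (n + 1) ^ 3)) \<in> O(\<lambda>n. real n ^ 3)"
  \<comment> \<open>For n at least 1, n + 1 is at most 2 * n, which gives the factor 8 = 2 ^
    3.\<close>
  proof (rule bigoI[where c = "real (K * 8)"], rule eventually_mono[OF eventually_ge_at_top[of 1]])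
    fix n :: nat assume "n \<ge> 1"
    then have "(n + 1) ^ 3 \<le> (2 * n) ^ 3" by (intro power_mono) auto
    then have "K * (n + 1) ^ 3 \<le> K * 8 * n ^ 3" by (simp add: power_mult_distrib)
    then have "real (K * (n + 1) ^ 3) \<le> real (K * 8 * n ^ 3)" by (rule of_nat_mono)
    then show "norm (real (K * (n + 1) ^ 3)) \<le> real (K * 8) * norm (real n ^ 3)" by simp
  qed
  moreover have "(\<lambda>n. real (n + 4)) \<in> O(\<lambda>n. real n ^ 1)"
  proof (rule bigoI[where c = 5], rule eventually_mono[OF eventually_ge_at_top[of 1]])
    fix n :: nat assume "n \<ge> 1"
    then show "norm (real (n + 4)) \<le> 5 * norm (real n ^ 1)" by simp
  qed
  ultimately show "\<exists>(P :: com) (T :: nat \<Rightarrow> nat) (W :: nat \<Rightarrow> nat) (d :: nat).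
      (\<lambda>n. real (T n)) \<in> O(\<lambda>n. real n ^ 3) \<and>
      (\<lambda>n. real (W n)) \<in> O(\<lambda>n. real n ^ d) \<and>
      (\<forall>(n :: nat) (G :: nat ugraph).
        n \<ge> 1 \<and> simple_graph G \<and> verts G = {..<n} \<and> cobipartite G \<and>
        free_of G (complement two_P3) \<longrightarrow>
        (\<exists>t s. exec (W n) G P (\<lambda>_ _. 0) t s \<and> t \<le> T n \<and> correct_output G s))"
    using program_correct unfolding K_def
    by (intro exI[of _ "program ?ps"] exI[of _ "\<lambda>n. K * (n + 1) ^ 3"] exI[of _ "\<lambda>n. n + 4"] exI[of _ 1])
       (simp add: K_def)
qed

end
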